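(* Let $n\ge 1$ and let $M_n=X_1+\dots+X_n$ be a martingale with respect to a filtration $\mathcal F_0\subset\mathcal F_1\subset\dots\subset\mathcal F_n$ (with $M_0=X_0=0$), whose differences satisfy $X_k\le 1$ almost surely for $k=1,\dots,n$. Let $c_k$ be the conditional kurtosis of $X_k$ given $\mathcal F_{k-1}$, and assume that there are non-random real numbers $\varkappa_1,\dots,\varkappa_n$ (necessarily $\varkappa_k\ge1$) with $$c_k\le\varkappa_k \quad\text{almost surely},\qquad k=1,2,\dots,n.$$ Let $v(t)=\tfrac12\bigl(t+1+\sqrt{(t+1)^2-4}\bigr)$ for $t\ge1$, and put $$\sigma^2=\frac{v(\varkappa_1)+\dots+v(\varkappa_n)}{n},\qquad \varkappa=\frac1{\sigma^2}-1+\sigma^2 .$$ Then the Bernoulli random variable $\varepsilon=\varepsilon(\sigma^2)$ has variance $\sigma^2$ and kurtosis $\varkappa$, and, if $T_n$ is a sum of $n$ independent copies of $\varepsilon(\sigma^2)$, then for every $x\in\mathbb R$ $$\mathbb P\{M_n\ge x\}\le\inf_{h>0}e^{-hx}\,\mathbb E\,e^{hT_n}\qquad\text{and}\qquad \mathbb P\{M_n\ge x\}\le\inf_{h<x}(x-h)^{-2}\,\mathbb E\,(T_n-h)_+^2 .$$ In the special case where $\varkappa_1=\dots=\varkappa_n=\varkappa$, the Bernoulli random variable has kurtosis $\varkappa$ and variance $\sigma^2=v(\varkappa)$.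
   Context: For a martingale $M_k=X_1+\dots+X_k$ ($0\le k\le n$), with each $M_k$ being $\mathcal F_k$-measurable, the conditional variance and conditional kurtosis of the difference $X_k$ are the $\mathcal F_{k-1}$-measurable random variables $$s_k^2=\mathbb E(X_k^2\mid\mathcal F_{k-1}),\qquad c_k=\mathbb E(X_k^4\mid\mathcal F_{k-1})/s_k^4,$$ where it is understood that $s_k^2<\infty$ almost surely, and by convention $c_k=1$ where $s_k=0$. For $\sigma^2>0$, the Bernoulli random variable $\varepsilon=\varepsilon(\sigma^2)$ is the two-valued random variable with $\mathbb P\{\varepsilon=-\sigma^2\}=q$ and $\mathbb P\{\varepsilon=1\}=p$, where $q=\frac1{1+\sigma^2}$, $p=1-q=\frac{\sigma^2}{1+\sigma^2}$; it satisfies $\mathbb E\varepsilon=0$, $\mathbb E\varepsilon^2=\sigma^2$. The kurtosis of a mean-zero random variable $X$ with variance $\sigma^2>0$ is $\mathbb E X^4/\sigma^4$. Notation: $(t)_+^2=(\max\{0,t\})^2$. *)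

theory Defs
  imports "HOL-Probability.Probability"
begin

text \<open>A martingale with finite horizon: only the times $0, \dots, n$ matter, and nothing is
  assumed about \<^term>\<open>F k\<close> and \<^term>\<open>S k\<close> for \<^term>\<open>k > n\<close>.\<close>

definition filtration_upto :: "'a measure \<Rightarrow> (nat \<Rightarrow> 'a measure) \<Rightarrow> nat \<Rightarrow> bool" where
  "filtration_upto P F n \<longleftrightarrow>
     (\<forall>k\<le>n. subalgebra P (F k)) \<and> (\<forall>k\<le>n. \<forall>j\<le>k. sets (F j) \<subseteq> sets (F k))"

definition martingale_upto ::
    "'a measure \<Rightarrow> (nat \<Rightarrow> 'a measure) \<Rightarrow> (nat \<Rightarrow> 'a \<Rightarrow> real) \<Rightarrow> nat \<Rightarrow> bool" where
  "martingale_upto P F S n \<longleftrightarrow>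
     filtration_upto P F n \<and>
     (\<forall>k\<le>n. S k \<in> borel_measurable (F k) \<and> integrable P (S k)) \<and>
     (\<forall>k\<le>n. \<forall>j\<le>k. AE \<omega> in P. real_cond_exp P (F j) (S k) \<omega> = S j \<omega>)"

text \<open>The conditional second and fourth moments are those of nonnegative random variables with
  values in $[0,\infty]$: neither \<^term>\<open>\<lambda>\<omega>. X \<omega> ^ 2\<close> nor \<^term>\<open>\<lambda>\<omega>. X \<omega> ^ 4\<close> need be integrable,
  and then \<^const>\<open>real_cond_exp\<close> would carry no information.  These definitions are
  meant for \<^term>\<open>X\<close> with conditional mean zero.\<close>

definition cond_variance :: "'a measure \<Rightarrow> 'a measure \<Rightarrow> ('a \<Rightarrow> real) \<Rightarrow> 'a \<Rightarrow> ennreal" where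
  "cond_variance P G X = nn_cond_exp P G (\<lambda>\<omega>. ennreal (X \<omega> ^ 2))"

text \<open>The quotient has its usual meaning only where the conditional variance is finite, since
  \<^term>\<open>a / \<infinity> = (0::ennreal)\<close>; finiteness has to be required separately.\<close>

definition cond_kurtosis :: "'a measure \<Rightarrow> 'a measure \<Rightarrow> ('a \<Rightarrow> real) \<Rightarrow> 'a \<Rightarrow> ennreal" where
  "cond_kurtosis P G X \<omega> =
     (if cond_variance P G X \<omega> = 0 then 1
      else nn_cond_exp P G (\<lambda>\<omega>. ennreal (X \<omega> ^ 4)) \<omega> / cond_variance P G X \<omega> ^ 2)"

definition kurtosis :: "'a measure \<Rightarrow> ('a \<Rightarrow> real) \<Rightarrow> real" where
  "kurtosis P X = prob_space.expectation P (\<lambda>\<omega>. X \<omega> ^ 4) / (prob_space.variance P X) ^ 2"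

text \<open>The law of $\varepsilon(\sigma^2)$; the argument \<open>s\<close> stands for $\sigma^2$ and should be
  positive.\<close>

definition bernoulli_law :: "real \<Rightarrow> real pmf" where
  "bernoulli_law s = map_pmf (\<lambda>b. if b then 1 else - s) (bernoulli_pmf (s / (1 + s)))"

lemma pmf_bernoulli_law:
  assumes "s > 0"
  shows "pmf (bernoulli_law s) (- s) = 1 / (1 + s)"
    and "pmf (bernoulli_law s) 1 = s / (1 + s)"
    and "set_pmf (bernoulli_law s) = {- s, 1}"
proof -
  let ?f = "\<lambda>b. if b then 1 else - s"
  have inj: "inj ?f"
    using assms by (auto simp: inj_on_def split: if_splits)
  have p: "0 < s / (1 + s)" "s / (1 + s) < 1"
    using assms by (auto simp: field_simps)
  show "pmf (bernoulli_law s) (- s) = 1 / (1 + s)"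
    using pmf_map_inj'[OF inj, of "bernoulli_pmf (s / (1 + s))" False] p assms
    by (simp add: bernoulli_law_def field_simps)
  show "pmf (bernoulli_law s) 1 = s / (1 + s)"
    using pmf_map_inj'[OF inj, of "bernoulli_pmf (s / (1 + s))" True] p
    by (simp add: bernoulli_law_def)
  show "set_pmf (bernoulli_law s) = {- s, 1}"
    using p by (auto simp: bernoulli_law_def set_pmf_bernoulli UNIV_bool)
qed

definition indep_copies ::
    "'b measure \<Rightarrow> (nat \<Rightarrow> 'b \<Rightarrow> real) \<Rightarrow> nat \<Rightarrow> real pmf \<Rightarrow> bool" where
  "indep_copies N Y n \<mu> \<longleftrightarrow>
     prob_space N \<and>
     prob_space.indep_vars N (\<lambda>_. borel) Y {1..n} \<and>
     (\<forall>k\<in>{1..n}. distr N borel (Y k) = distr (measure_pmf \<mu>) borel (\<lambda>y. y))"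

text \<open>The larger root \<open>s\<close> of $1/s - 1 + s = t$, for \<open>t \<ge> 1\<close>.\<close>

definition v :: "real \<Rightarrow> real" where
  "v t = (t + 1 + sqrt ((t + 1)\<^sup>2 - 4)) / 2"

end

theory Submission
  imports Defs
begin

text \<open>The kurtosis bound controls the conditional variance: for $r \ge 1$ and $X \le 1$ the inequality
  $(X + r)^2 (1 - X) (2r - 1 - X) \ge 0$, taken at $r = s_k^2$, yields
  $c_k \ge 1/s_k^2 - 1 + s_k^2$ whenever $s_k^2 \ge 1$, hence always $s_k^2 \le v(\varkappa_k)$.

  Both tail bounds are Markov's inequality for a nonnegative increasing convex function $g$ with convex
  derivative.  For such $g$, the parabola that touches $g$ at $-s$ and meets it again at $1$ dominates
  $g$ on $(-\infty, 1]$, so replacing an increment of conditional variance at most $s$ by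
  $\varepsilon(s)$ increases $\mathbb{E}\, g$.  Finally, moving two of the resulting
  variances towards each other while keeping their sum increases $\mathbb{E}\, g$ again, because the signed
  difference of the two laws is orthogonal to quadratic polynomials; finitely many such
  moves make all variances equal to their mean $\sigma^2$.\<close>

subsection \<open>Functions with convex derivative\<close>

lemma convex_on_three_points:
  fixes f :: "real \<Rightarrow> real"
  assumes "convex_on UNIV f" "a < b" "b < c"
  shows "(c - a) * f b \<le> (c - b) * f a + (b - a) * f c"
proof -
  define u where "u = (b - a) / (c - a)"
  have u: "0 \<le> u" "u \<le> 1" "u * (c - a) = b - a"
    using assms by (simp_all add: u_def)
  have b: "b = (1 - u) *\<^sub>R a + u *\<^sub>R c"
    using u(3) by (simp add: algebra_simps)
  have "f b \<le> (1 - u) * f a + u * f c"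
    using convex_onD[OF assms(1) u(1,2), of a c] unfolding b[symmetric] by simp
  then have "(c - a) * f b \<le> (c - a) * ((1 - u) * f a + u * f c)"
    using assms by (intro mult_left_mono) auto
  also have "\<dots> = (c - b) * f a + (b - a) * f c"
    using u(3) by algebra
  finally show ?thesis .
qed

lemma convex_on_two_zeros:
  fixes f :: "real \<Rightarrow> real"
  assumes f: "convex_on UNIV f" and ab: "a < b" and z: "f a = 0" "f b = 0"
  shows "x \<le> a \<Longrightarrow> 0 \<le> f x" "a \<le> x \<Longrightarrow> x \<le> b \<Longrightarrow> f x \<le> 0" "b \<le> x \<Longrightarrow> 0 \<le> f x"
proof -
  show "0 \<le> f x" if "x \<le> a"
    using convex_on_three_points[OF f, of x a b] that ab z
    by (cases "x = a") (auto simp: zero_le_mult_iff)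
  show "f x \<le> 0" if "a \<le> x" "x \<le> b"
    using convex_on_three_points[OF f, of a x b] that ab z
    by (cases "x = a"; cases "x = b") (auto simp: mult_le_0_iff)
  show "0 \<le> f x" if "b \<le> x"
    using convex_on_three_points[OF f, of a b x] that ab z
    by (cases "x = b") (auto simp: zero_le_mult_iff)
qed

lemma mono_between:
  fixes f :: "real \<Rightarrow> real"
  assumes "\<And>x. (f has_real_derivative f' x) (at x)" "x \<le> y" "\<And>z. x \<le> z \<Longrightarrow> z \<le> y \<Longrightarrow> 0 \<le> f' z"
  shows "f x \<le> f y"
  using assms DERIV_nonneg_imp_nondecreasing[of x y f] by blast

lemma antimono_between:
  fixes f :: "real \<Rightarrow> real"
  assumes "\<And>x. (f has_real_derivative f' x) (at x)" "x \<le> y" "\<And>z. x \<le> z \<Longrightarrow> z \<le> y \<Longrightarrow> f' z \<le> 0"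
  shows "f y \<le> f x"
  using assms DERIV_nonpos_imp_nonincreasing[of x y f] by blast

lemma Rolle_zero:
  fixes f :: "real \<Rightarrow> real"
  assumes d: "\<And>x. (f has_real_derivative f' x) (at x)" and "p < r" "f p = f r"
  obtains z where "p < z" "z < r" "f' z = 0"
proof -
  have "continuous_on {p..r} f"
    using d by (meson DERIV_continuous continuous_at_imp_continuous_on)
  moreover have "f differentiable (at x)" for x
    using d real_differentiable_def by blast
  ultimately obtain z where "p < z" "z < r" "DERIV f z :> 0"
    using Rolle[of p r f] assms by auto
  with d that show thesis
    by (metis DERIV_unique)
qed

text \<open>Rolle gives zeros \<open>y1\<close> and \<open>y2\<close> of the convex function
  \<open>f'\<close>, one in each gap. So \<open>f'\<close> is nonnegative outside
  [\<open>y1\<close>, \<open>y2\<close>] and nonpositive inside, \<open>f\<close> increases,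
  decreases and increases again, and its known zeros fix the signs.\<close>

lemma three_zeros:
  fixes f :: "real \<Rightarrow> real"
  assumes d: "\<And>x. (f has_real_derivative f' x) (at x)" and c: "convex_on UNIV f'"
    and lt: "p < r" "r < t" and z: "f p = 0" "f r = 0" "f t = 0"
  shows "x \<le> p \<Longrightarrow> f x \<le> 0" "p \<le> x \<Longrightarrow> x \<le> r \<Longrightarrow> 0 \<le> f x" "t \<le> x \<Longrightarrow> 0 \<le> f x"
proof -
  obtain y1 where y1: "p < y1" "y1 < r" "f' y1 = 0"
    using Rolle_zero[OF d, of p r] lt z by auto
  obtain y2 where y2: "r < y2" "y2 < t" "f' y2 = 0"
    using Rolle_zero[OF d, of r t] lt z by auto
  note signs = convex_on_two_zeros[OF c, of y1 y2]
  show "f x \<le> 0" if "x \<le> p"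
    using mono_between[OF d, of x p] signs(1) that y1 y2 z by fastforce
  show "0 \<le> f x" if "p \<le> x" "x \<le> r"
  proof (cases "x \<le> y1")
    case True
    then show ?thesis
      using mono_between[OF d, of p x] signs(1) that y1 y2 z by fastforce
  next
    case False
    then show ?thesis
      using antimono_between[OF d, of x r] signs(2) that y1 y2 z by fastforce
  qed
  show "0 \<le> f x" if "t \<le> x"
    using mono_between[OF d, of t x] signs(3) that y1 y2 z by fastforce
qed

text \<open>Here \<open>p\<close> is itself one zero of \<open>f'\<close>, and Rolle supplies a
  second one \<open>y\<close> between \<open>p\<close> and \<open>t\<close>. Thus \<open>f\<close>
  rises to 0 at \<open>p\<close>, falls until \<open>y\<close>, and rises back to 0 at
  \<open>t\<close>.\<close>

lemma double_zero:
  fixes f :: "real \<Rightarrow> real"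
  assumes d: "\<And>x. (f has_real_derivative f' x) (at x)" and c: "convex_on UNIV f'"
    and lt: "p < t" and z: "f p = 0" "f' p = 0" "f t = 0" and "x \<le> t"
  shows "f x \<le> 0"
proof -
  obtain y where y: "p < y" "y < t" "f' y = 0"
    using Rolle_zero[OF d, of p t] lt z by auto
  note signs = convex_on_two_zeros[OF c, of p y]
  consider "x \<le> p" | "p \<le> x" "x \<le> y" | "y \<le> x" by linarith
  then show ?thesis
  proof cases
    case 1
    then show ?thesis
      using mono_between[OF d, of x p] signs(1) y z by fastforce
  next
    case 2
    then show ?thesis
      using antimono_between[OF d, of p x] signs(2) y z by fastforce
  next
    case 3
    then show ?thesis
      using mono_between[OF d, of x t] signs(3) \<open>x \<le> t\<close> y z by fastforce
  qed
qed

subsection \<open>Adding Bernoulli variables\<close>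

text \<open>The class contains both payoffs of the tail bounds and is closed under translation and
  under averaging over a Bernoulli step, which is what the inductions require. Convexity is imposed
  on the given \<open>g'\<close> rather than as a sign of a higher derivative, because the truncated
  square has no second derivative at its kink.\<close>

definition smooth_payoff :: "(real \<Rightarrow> real) \<Rightarrow> (real \<Rightarrow> real) \<Rightarrow> bool" where
  "smooth_payoff g g' \<longleftrightarrow>
     (\<forall>x. (g has_real_derivative g' x) (at x)) \<and> convex_on UNIV g' \<and> mono g' \<and>
     (\<forall>x. 0 \<le> g x) \<and> (\<forall>x. 0 \<le> g' x)"

text \<open>\<open>bern s g x\<close> is the expectation of $g(x + \varepsilon(s))$.\<close>

definition bern :: "real \<Rightarrow> (real \<Rightarrow> real) \<Rightarrow> real \<Rightarrow> real" where
  "bern s g x = (g (x - s) + s * g (x + 1)) / (1 + s)"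

lemma convex_on_UNIV_shift:
  fixes f :: "real \<Rightarrow> real"
  assumes "convex_on UNIV f"
  shows "convex_on UNIV (\<lambda>x. f (x + c))"
proof (rule convex_onI)
  fix t x y :: real
  assume "0 < t" "t < 1"
  moreover have "(1 - t) *\<^sub>R x + t *\<^sub>R y + c = (1 - t) *\<^sub>R (x + c) + t *\<^sub>R (y + c)"
    by (simp add: algebra_simps)
  ultimately show "f ((1 - t) *\<^sub>R x + t *\<^sub>R y + c) \<le> (1 - t) * f (x + c) + t * f (y + c)"
    using convex_onD[OF assms, of t "x + c" "y + c"] by simp
qed simp

lemma bern_combination: "bern s g = (\<lambda>x. (1 / (1 + s)) * g (x + (- s)) + (s / (1 + s)) * g (x + 1))"
  by (auto simp: bern_def add_divide_distrib)

lemma smooth_payoff_DERIV_shift: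
  "smooth_payoff g g' \<Longrightarrow> ((\<lambda>x. g (x + c)) has_real_derivative g' (x + c)) (at x)"
  by (rule DERIV_shift[THEN iffD1]) (simp add: smooth_payoff_def)

lemma smooth_payoff_shift:
  assumes "smooth_payoff g g'"
  shows "smooth_payoff (\<lambda>x. g (x + c)) (\<lambda>x. g' (x + c))"
  using smooth_payoff_DERIV_shift[OF assms, of c] assms convex_on_UNIV_shift[of g' c]
  by (simp add: smooth_payoff_def mono_def)

lemma smooth_payoff_bern:
  assumes g: "smooth_payoff g g'" and s: "s > 0"
  shows "smooth_payoff (bern s g) (bern s g')"
proof -
  have d: "(bern s g has_real_derivative bern s g' x) (at x)" for x
    unfolding bern_combination by (intro DERIV_add DERIV_cmult smooth_payoff_DERIV_shift[OF g])
  have c: "convex_on UNIV (bern s g')"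
    unfolding bern_combination
    using g s by (intro convex_on_add convex_on_cmul convex_on_UNIV_shift) (auto simp: smooth_payoff_def)
  have m: "mono (bern s g')"
    unfolding bern_combination
    using g s by (intro monoI add_mono mult_left_mono) (auto simp: smooth_payoff_def mono_def)
  show ?thesis
    using d c m g s by (auto simp: smooth_payoff_def bern_def)
qed

lemma bern_mono: "s > 0 \<Longrightarrow> (\<And>x. f x \<le> g x) \<Longrightarrow> bern s f x \<le> bern s g x"
  unfolding bern_combination by (intro add_mono mult_left_mono) auto

lemma bern_commute: "bern a (bern b g) = bern b (bern a g)"
  by (auto simp: bern_def field_simps add_divide_distrib)

text \<open>A Bernoulli step has mean 0 and variance \<open>s\<close>, so only the constant term
  moves. Consecutive steps therefore act on quadratic polynomials through the sum of their variances
  alone.\<close>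

lemma bern_quadratic:
  assumes "s > 0"
  shows "bern s (\<lambda>x. u + w * x + z * x\<^sup>2) = (\<lambda>x. (u + z * s) + w * x + z * x\<^sup>2)"
proof -
  have "(u + w * (x - s) + z * (x - s)\<^sup>2) + s * (u + w * (x + 1) + z * (x + 1)\<^sup>2)
      = ((u + z * s) + w * x + z * x\<^sup>2) * (1 + s)" for x
    by algebra
  with assms show ?thesis
    by (auto simp: bern_def)
qed

lemma bern_diff: "bern s (\<lambda>x. f x - g x) = (\<lambda>x. bern s f x - bern s g x)"
  by (auto simp: bern_def diff_divide_distrib[symmetric] algebra_simps)

lemma convex_on_diff_affine:
  fixes f :: "real \<Rightarrow> real"
  assumes "convex_on UNIV f"
  shows "convex_on UNIV (\<lambda>x. f x - (w + z * x))"
proof (rule convex_onI)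
  fix t x y :: real
  assume "0 < t" "t < 1"
  then show "f ((1 - t) *\<^sub>R x + t *\<^sub>R y) - (w + z * ((1 - t) *\<^sub>R x + t *\<^sub>R y))
      \<le> (1 - t) * (f x - (w + z * x)) + t * (f y - (w + z * y))"
    using convex_onD[OF assms, of t x y] by (simp add: algebra_simps)
qed simp

section \<open>Moving two variances towards each other\<close>

lemma quadratic_interpolation:
  fixes p r t :: real
  assumes "p \<noteq> r" "r \<noteq> t" "p \<noteq> t"
  obtains u w z where "u + w * p + z * p\<^sup>2 = fp" "u + w * r + z * r\<^sup>2 = fr" "u + w * t + z * t\<^sup>2 = ft"
proof -
  \<comment> \<open>Newton's divided differences: the coefficients supplied below are those of
    \<open>fp + w1 * (x - p) + z * (x - p) * (x - r)\<close> after expansion in powers of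
    \<open>x\<close>.\<close>
  define w1 where "w1 = (fr - fp) / (r - p)"
  define z where "z = ((ft - fp) / (t - p) - w1) / (t - r)"
  have 1: "w1 * (r - p) = fr - fp"
    using assms by (simp add: w1_def)
  have "z * (t - r) = (ft - fp) / (t - p) - w1"
    using assms by (simp add: z_def)
  then have 2: "(z * (t - r) + w1) * (t - p) = ft - fp"
    using assms by simp
  show thesis
  proof (rule that[of "fp - w1 * p + z * p * r" "w1 - z * (p + r)" z])
    show "fp - w1 * p + z * p * r + (w1 - z * (p + r)) * p + z * p\<^sup>2 = fp"
      by (simp add: algebra_simps power2_eq_square)
    show "fp - w1 * p + z * p * r + (w1 - z * (p + r)) * r + z * r\<^sup>2 = fr" using 1 by algebra
    show "fp - w1 * p + z * p * r + (w1 - z * (p + r)) * t + z * t\<^sup>2 = ft" using 2 by algebra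
  qed
qed

text \<open>The denominator is kept in expanded form so that, for a fixed sum of the two variances,
  it depends only on their product.\<close>

lemma bern_bern_0:
  assumes "a > 0" "b > 0"
  shows "bern a (bern b h) 0 = (h (- a - b) + b * h (1 - a) + a * h (1 - b) + a * b * h 2) / (1 + (a + b) + a * b)"
proof -
  have "bern a (bern b h) 0 = ((h (- a - b) + b * h (1 - a)) / (1 + b) + a * ((h (1 - b) + b * h 2) / (1 + b))) / (1 + a)"
    by (simp add: bern_def)
  also have "\<dots> = (h (- a - b) + b * h (1 - a) + a * h (1 - b) + a * b * h 2) / ((1 + b) * (1 + a))"
    by (simp add: add_divide_distrib[symmetric] algebra_simps)
  also have "(1 + b) * (1 + a) = 1 + (a + b) + a * b"
    by algebra
  finally show ?thesis .
qed

text \<open>Both sides agree on quadratic polynomials, so the one through the graph of \<^term>\<open>g\<close> at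
  $1-b$, $1-c$, $1-a$ may be subtracted; the differences at $-a-b$, $1-d$ and $2$ then have the right signs.\<close>

lemma bern_spread_zero:
  assumes g: "smooth_payoff g g'" and ab: "0 < a" "a < c" "c \<le> d" and s: "a + b = c + d"
  shows "bern a (bern b g) 0 \<le> bern c (bern d g) 0"
proof -
  obtain u w z where q: "u + w * (1 - b) + z * (1 - b)\<^sup>2 = g (1 - b)"
      "u + w * (1 - c) + z * (1 - c)\<^sup>2 = g (1 - c)" "u + w * (1 - a) + z * (1 - a)\<^sup>2 = g (1 - a)"
    using ab s by (rule_tac quadratic_interpolation[of "1 - b" "1 - c" "1 - a"]) auto
  define h where "h = (\<lambda>x. g x - (u + w * x + z * x\<^sup>2))"
  have dh: "(h has_real_derivative g' x - (w + 2 * z * x)) (at x)" for x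
    unfolding h_def using g
    by (auto intro!: derivative_eq_intros simp: smooth_payoff_def)
  have ch: "convex_on UNIV (\<lambda>x. g' x - (w + 2 * z * x))"
    using g by (intro convex_on_diff_affine) (auto simp: smooth_payoff_def)
  have hz: "h (1 - b) = 0" "h (1 - c) = 0" "h (1 - a) = 0"
    using q by (simp_all add: h_def)
  have lt: "1 - b < 1 - c" "1 - c < 1 - a"
    using ab s by auto
  note signs = three_zeros[OF dh ch lt hz]
  have h0: "h (- a - b) \<le> 0" and h1: "0 \<le> h (1 - d)" and h2: "0 \<le> h 2"
    using signs(1)[of "- a - b"] signs(2)[of "1 - d"] signs(3)[of 2] ab s by auto
  have b: "0 < b" "0 < c" "0 < d"
    using ab s by auto
  \<comment> \<open>With the sum fixed, the closer pair has the larger product. The denominator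
    therefore grows to \<open>D\<close>, which brings the nonpositive term at \<open>- a - b\<close>
    nearer to 0, and the weight of the point 2 grows as well.\<close>
  have "c * d - a * b = (c - a) * (d - a)"
    using s by algebra
  moreover have "0 \<le> (c - a) * (d - a)"
    using ab by simp
  ultimately have cd: "a * b \<le> c * d"
    by linarith
  define D where "D = 1 + (a + b) + c * d"
  have D: "0 < D" "0 < 1 + (a + b) + a * b"
    using b ab by (auto simp: D_def intro!: add_pos_pos)
  have "h (- a - b) / (1 + (a + b) + a * b) \<le> h (- a - b) / D"
    using h0 cd D by (intro divide_left_mono_neg) (auto simp: D_def)
  moreover have "a * b / (1 + (a + b) + a * b) * h 2 \<le> c * d / D * h 2"
  proof (intro mult_right_mono h2)
    have "a * b * (1 + (a + b)) \<le> c * d * (1 + (a + b))"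
      using cd b ab by (intro mult_right_mono) auto
    then have "a * b * D \<le> c * d * (1 + (a + b) + a * b)"
      by (simp add: D_def algebra_simps)
    then show "a * b / (1 + (a + b) + a * b) \<le> c * d / D"
      using D by (simp only: pos_divide_le_eq pos_le_divide_eq times_divide_eq_left)
  qed
  moreover have "0 \<le> c * h (1 - d) / D"
    using h1 b D by simp
  moreover have "bern a (bern b h) 0 = h (- a - b) / (1 + (a + b) + a * b) + a * b / (1 + (a + b) + a * b) * h 2"
    using b ab hz by (simp add: bern_bern_0 add_divide_distrib)
  moreover have "bern c (bern d h) 0 = h (- a - b) / D + c * h (1 - d) / D + c * d / D * h 2"
  proof -
    have "- c - d = - a - b" "1 + (c + d) + c * d = D"
      using s by (simp_all add: D_def)
    then show ?thesis
      using b ab hz by (simp add: bern_bern_0 add_divide_distrib)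
  qed
  ultimately have "bern a (bern b h) 0 \<le> bern c (bern d h) 0"
    by linarith
  moreover have "bern a (bern b (\<lambda>x. u + w * x + z * x\<^sup>2)) 0 = bern c (bern d (\<lambda>x. u + w * x + z * x\<^sup>2)) 0"
  proof -
    have "u + z * b + z * a = u + z * d + z * c"
      using s by algebra
    then show ?thesis
      using b ab by (simp add: bern_quadratic)
  qed
  ultimately show ?thesis
    unfolding h_def bern_diff by linarith
qed

lemma bern_shift: "bern s (\<lambda>x. g (x + c)) = (\<lambda>x. bern s g (x + c))"
  by (auto simp: bern_def algebra_simps)

lemma bern_spread:
  assumes g: "smooth_payoff g g'" and "0 < a" "a < m" "m < b"
  shows "bern a (bern b g) x \<le> bern m (bern (a + b - m) g) x"
proof -
  have *: "bern a (bern b g) x \<le> bern c (bern d g) x" if "a < c" "c \<le> d" "a + b = c + d" for c d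
    using bern_spread_zero[OF smooth_payoff_shift[OF g, of x] \<open>0 < a\<close> that]
    by (simp add: bern_shift)
  \<comment> \<open>The fact \<open>*\<close> expects the smaller of the two new variances first;
    \<open>bern_commute\<close> covers the other order.\<close>
  show ?thesis
  proof (cases "m \<le> a + b - m")
    case True
    then show ?thesis using assms by (intro *) auto
  next
    case False
    then show ?thesis unfolding bern_commute[of m] using assms by (intro *) auto
  qed
qed

lemma bern_fold_perm: "mset xs = mset ys \<Longrightarrow> fold bern xs g = fold bern ys g"
  by (rule fun_cong[OF fold_multiset_equiv]) (auto simp: fun_eq_iff bern_commute)

lemma bern_fold_mono:
  "(\<And>s. s \<in> set xs \<Longrightarrow> s > 0) \<Longrightarrow> (\<And>x. f x \<le> g x) \<Longrightarrow> fold bern xs f x \<le> fold bern xs g x"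
  by (induction xs arbitrary: f g x) (auto simp: bern_mono)

text \<open>The right-hand side is the parabola in \<^term>\<open>x\<close> that touches \<^term>\<open>\<lambda>x. g (y + x)\<close> at
  \<^term>\<open>- s\<close> and meets it at \<^term>\<open>1\<close>.\<close>

lemma bern_one_step:
  fixes x y s :: real
  assumes g: "smooth_payoff g g'" and s: "s > 0" and x: "x \<le> 1"
  defines "z \<equiv> (g (y + 1) - g (y - s) - g' (y - s) * (1 + s)) / (1 + s)\<^sup>2"
  shows "g (y + x) \<le> g (y - s) + g' (y - s) * (x + s) + z * (x + s)\<^sup>2"
    and "0 \<le> z" and "z \<le> g (y + 1) / (1 + s)\<^sup>2"
    and "g (y - s) + g' (y - s) * s + z * (s\<^sup>2 + s) = bern s g y"
proof -
  define h where "h = (\<lambda>x. g (y + x) - (g (y - s) + g' (y - s) * (x + s) + z * (x + s)\<^sup>2))"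
  have dh: "(h has_real_derivative g' (x + y) - ((g' (y - s) + 2 * z * s) + 2 * z * x)) (at x)" for x
    unfolding h_def add.commute[of y]
    by (rule derivative_eq_intros smooth_payoff_DERIV_shift[OF g] refl)+ (simp add: algebra_simps)
  have ch: "convex_on UNIV (\<lambda>x. g' (x + y) - ((g' (y - s) + 2 * z * s) + 2 * z * x))"
    using g by (intro convex_on_diff_affine convex_on_UNIV_shift) (auto simp: smooth_payoff_def)
  have z: "z * (1 + s)\<^sup>2 = g (y + 1) - g (y - s) - g' (y - s) * (1 + s)"
    using s by (simp add: z_def)
  have "h x \<le> 0"
  \<comment> \<open>The parabola is tangent at \<open>- s\<close>, so \<open>h\<close> has a double
    zero there; the choice of \<open>z\<close> produces the simple zero at 1.\<close>
  proof (rule double_zero[OF dh ch, of "- s" 1])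
    show "h 1 = 0"
      using z by (simp add: h_def)
  qed (use s x in \<open>auto simp: h_def\<close>)
  then show "g (y + x) \<le> g (y - s) + g' (y - s) * (x + s) + z * (x + s)\<^sup>2"
    by (simp add: h_def)
  \<comment> \<open>Since \<open>g'\<close> is increasing, \<open>g\<close> minus its tangent slope
    at \<open>y - s\<close> increases to the right of that point. So \<open>g (y + 1)\<close> lies
    above the tangent, which is the sign of \<open>z\<close>.\<close>
  have "g (y - s) - g' (y - s) * (y - s) \<le> g (y + 1) - g' (y - s) * (y + 1)"
  proof (rule mono_between[where f="\<lambda>x. g x - g' (y - s) * x" and f'="\<lambda>x. g' x - g' (y - s)"])
    show "((\<lambda>x. g x - g' (y - s) * x) has_real_derivative g' x - g' (y - s)) (at x)" for x
      using g by (auto intro!: derivative_eq_intros simp: smooth_payoff_def)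
  qed (use g s in \<open>auto simp: smooth_payoff_def mono_def\<close>)
  then show "0 \<le> z"
    by (simp add: z_def algebra_simps)
  have "0 \<le> g (y - s)" "0 \<le> g' (y - s) * (1 + s)"
    using g s by (auto simp: smooth_payoff_def)
  then show "z \<le> g (y + 1) / (1 + s)\<^sup>2"
    using s by (auto simp: z_def smooth_payoff_def intro!: divide_right_mono)
  \<comment> \<open>The bracket is the expectation of the parabola at a centered variable of
    variance \<open>s\<close>. It equals that of \<open>g\<close> at the Bernoulli variable because
    parabola and payoff agree at both atoms \<open>- s\<close> and 1.\<close>
  have "(g (y - s) + g' (y - s) * s + z * (s\<^sup>2 + s)) * (1 + s) = g (y - s) + s * g (y + 1)"
    using z by algebra
  then show "g (y - s) + g' (y - s) * s + z * (s\<^sup>2 + s) = bern s g y"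
    using s by (simp add: bern_def eq_divide_eq)
qed

section \<open>The exponential and the truncated square as payoffs\<close>

lemma convex_on_exp_mult: "convex_on UNIV (\<lambda>x::real. exp (h * x))"
  by (rule f''_ge0_imp_convex[where f'="\<lambda>x. h * exp (h * x)" and f''="\<lambda>x. h\<^sup>2 * exp (h * x)"])
    (auto intro!: derivative_eq_intros simp: power2_eq_square)

lemma smooth_payoff_exp:
  assumes "h > 0"
  shows "smooth_payoff (\<lambda>x. exp (h * x)) (\<lambda>x. h * exp (h * x))"
proof -
  have "((\<lambda>x. exp (h * x)) has_real_derivative h * exp (h * x)) (at x)" for x
    by (auto intro!: derivative_eq_intros)
  moreover have "convex_on UNIV (\<lambda>x. h * exp (h * x))"
    using assms by (intro convex_on_cmul convex_on_exp_mult) auto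
  ultimately show ?thesis
    using assms by (auto simp: smooth_payoff_def mono_def)
qed

lemma DERIV_square_pos_part: "((\<lambda>x::real. (max 0 (x - h))\<^sup>2) has_real_derivative 2 * max 0 (x - h)) (at x)"
proof (cases "x = h")
  case True
  \<comment> \<open>At the kink the difference quotient is either 0 or \<open>y\<close>, hence at
    most |y| in absolute value.\<close>
  have "((\<lambda>y. (max 0 (h + y - h))\<^sup>2 / y) \<longlongrightarrow> 0) (at 0)"
  proof (rule Lim_null_comparison)
    show "\<forall>\<^sub>F y in at (0::real). norm ((max 0 (h + y - h))\<^sup>2 / y) \<le> \<bar>y\<bar>"
      by (intro always_eventually) (auto simp: max_def power2_eq_square)
    show "((\<lambda>y. \<bar>y\<bar>) \<longlongrightarrow> 0) (at (0::real))"
      by (rule tendsto_eq_intros) (auto intro: tendsto_eq_intros)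
  qed
  with True show ?thesis
    by (simp add: DERIV_def)
next
  case False
  show ?thesis
  proof (cases "x < h")
    case True
    have "((\<lambda>x. 0) has_real_derivative 0) (at x)" by simp
    then show ?thesis
      using True by (rule_tac has_field_derivative_transform_within_open[of "\<lambda>x. 0" _ _ "{..<h}"]) auto
  next
    case F: False
    have "((\<lambda>x. (x - h)\<^sup>2) has_real_derivative 2 * (x - h)) (at x)"
      by (auto intro!: derivative_eq_intros)
    then show ?thesis
      using F False by (rule_tac has_field_derivative_transform_within_open[of "\<lambda>x. (x - h)\<^sup>2" _ _ "{h<..}"]) auto
  qed
qed

lemma smooth_payoff_square_pos_part:
  "smooth_payoff (\<lambda>x. (max 0 (x - h))\<^sup>2) (\<lambda>x. 2 * max 0 (x - h))"
proof -
  have "convex_on UNIV (\<lambda>x. max 0 (x - h))"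
  proof (rule convex_onI)
    fix t x y :: real
    assume t: "0 < t" "t < 1"
    have "(1 - t) * (x - h) \<le> (1 - t) * max 0 (x - h)" "t * (y - h) \<le> t * max 0 (y - h)"
      "0 \<le> (1 - t) * max 0 (x - h)" "0 \<le> t * max 0 (y - h)"
      using t by (auto intro!: mult_left_mono)
    then show "max 0 ((1 - t) *\<^sub>R x + t *\<^sub>R y - h) \<le> (1 - t) * max 0 (x - h) + t * max 0 (y - h)"
      by (intro max.boundedI) (simp_all add: algebra_simps)
  qed simp
  then have "convex_on UNIV (\<lambda>x. 2 * max 0 (x - h))"
    by (intro convex_on_cmul) auto
  then show ?thesis
    by (auto simp: smooth_payoff_def DERIV_square_pos_part mono_def)
qed

text \<open>Induction on the length. If the mean \<open>m\<close> occurs in the list, it is set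
  aside and the remaining entries still have mean \<open>m\<close>. Otherwise some \<open>a\<close>
  < \<open>m\<close> < \<open>b\<close> occur, and replacing them by \<open>m\<close> and
  \<open>a + b - m\<close> keeps the sum, does not decrease the value by \<open>bern_spread\<close>,
  and creates an entry \<open>m\<close>.\<close>

lemma bern_fold_average:
  assumes "smooth_payoff g g'" "\<And>s. s \<in> set xs \<Longrightarrow> s > 0" "sum_list xs = real (length xs) * m"
  shows "fold bern xs g x \<le> fold bern (replicate (length xs) m) g x"
  using assms
proof (induction "length xs" arbitrary: xs g g')
  case 0
  then show ?case by simp
next
  case (Suc n)
  \<comment> \<open>\<open>fold\<close> applies the head of the list first, so the other
    \<open>n\<close> entries act on \<open>bern m f\<close>. This is again a smooth payoff, and the
    induction hypothesis applies to it.\<close>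
  have step: "fold bern (m # ys) f x \<le> fold bern (replicate (Suc n) m) f x"
    if "smooth_payoff f f'" "\<And>s. s \<in> set ys \<Longrightarrow> s > 0" "m > 0" "length ys = n"
      "sum_list (m # ys) = real (Suc n) * m" for f f' ys
  proof -
    have "sum_list ys = real (length ys) * m"
      using that(4,5) by (simp add: distrib_right)
    then have "fold bern ys (bern m f) x \<le> fold bern (replicate (length ys) m) (bern m f) x"
      using Suc.hyps(1)[of ys, OF that(4)[symmetric] smooth_payoff_bern[OF that(1,3)] that(2)] by simp
    then show ?thesis
      using that(4) by simp
  qed
  show ?case
  proof (cases "m \<in> set xs")
    case True
    then obtain ys zs where xs: "xs = ys @ m # zs"
      by (meson split_list)
    have "fold bern xs g = fold bern (m # ys @ zs) g"
      by (rule bern_fold_perm) (simp add: xs)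
    moreover have "fold bern (m # ys @ zs) g x \<le> fold bern (replicate (Suc n) m) g x"
    proof (rule step[OF Suc.prems(1)])
      show "\<And>s. s \<in> set (ys @ zs) \<Longrightarrow> s > 0" "m > 0"
        using Suc.prems(2) by (simp_all add: xs)
      show "length (ys @ zs) = n"
        using Suc.hyps(2) by (simp add: xs)
      show "sum_list (m # ys @ zs) = real (Suc n) * m"
        using Suc.prems(3) unfolding Suc.hyps(2)[symmetric] by (simp add: xs)
    qed
    ultimately show ?thesis
      unfolding Suc.hyps(2)[symmetric] by simp
  next
    case False
    \<comment> \<open>Were no entry below \<open>m\<close>, all would exceed it, since
      \<open>m\<close> is not in the list, and so would their average.\<close>
    obtain a where a: "a \<in> set xs" "a < m"
    proof (rule ccontr)
      assume "\<not> thesis"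
      with that False have "\<And>s. s \<in> set xs \<Longrightarrow> m < s"
        by (metis linorder_neqE_linordered_idom)
      then have "sum_list (map (\<lambda>_. m) xs) < sum_list (map (\<lambda>s. s) xs)"
        using Suc.hyps(2) by (intro sum_list_strict_mono) auto
      then show False
        using Suc.prems(3) by (simp add: sum_list_triv)
    qed
    obtain b where b: "b \<in> set xs" "m < b"
    proof (rule ccontr)
      assume "\<not> thesis"
      with that False have "\<And>s. s \<in> set xs \<Longrightarrow> s < m"
        by (metis linorder_neqE_linordered_idom)
      then have "sum_list (map (\<lambda>s. s) xs) < sum_list (map (\<lambda>_. m) xs)"
        using Suc.hyps(2) by (intro sum_list_strict_mono) auto
      then show False
        using Suc.prems(3) by (simp add: sum_list_triv)
    qed
    define zs where "zs = remove1 a (remove1 b xs)"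
    have remove: "mset (c # remove1 c ys) = mset ys" if "c \<in> set ys" for c :: real and ys
      using that by simp
    have "a \<in> set (remove1 b xs)"
      using a b by (simp add: in_set_remove1)
    then have "mset (a # zs) = mset (remove1 b xs)"
      unfolding zs_def by (rule remove)
    then have ms: "mset xs = mset (b # a # zs)"
      using remove[OF b(1)] by simp
    have len: "length xs = length zs + 2" and su: "sum_list xs = a + b + sum_list zs"
      using mset_eq_length[OF ms] arg_cong[OF ms, of sum_mset] by (simp_all add: sum_mset_sum_list)
    have pos: "s > 0" if "s \<in> set (b # a # zs)" for s
      using Suc.prems(2) that ms by (metis mset_eq_setD)
    have m: "0 < a" "0 < m" "0 < a + b - m"
      using pos[of a] pos[of b] a b by auto
    have "fold bern xs g x = fold bern zs (bern a (bern b g)) x"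
      using bern_fold_perm[OF ms] by simp
    also have "\<dots> \<le> fold bern zs (bern m (bern (a + b - m) g)) x"
      using pos a b by (intro bern_fold_mono bern_spread[OF Suc.prems(1)]) auto
    also have "\<dots> = fold bern (m # (a + b - m) # zs) g x"
      by (simp add: bern_commute)
    also have "\<dots> \<le> fold bern (replicate (Suc n) m) g x"
    proof (rule step[OF Suc.prems(1)])
      show "\<And>s. s \<in> set ((a + b - m) # zs) \<Longrightarrow> s > 0" "m > 0"
        using pos m by auto
      show "length ((a + b - m) # zs) = n"
        using Suc.hyps(2) len by simp
      show "sum_list (m # (a + b - m) # zs) = real (Suc n) * m"
        using Suc.prems(3) su unfolding Suc.hyps(2)[symmetric] by simp
    qed
    finally show ?thesis
      unfolding Suc.hyps(2)[symmetric] .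
  qed
qed

subsection \<open>Conditional variance and conditional kurtosis\<close>

lemma v_ge_1:
  assumes "t \<ge> 1"
  shows "v t \<ge> 1"
proof -
  have "2\<^sup>2 \<le> (t + 1)\<^sup>2"
    using assms by (intro power_mono) auto
  moreover define S where "S = sqrt ((t + 1)\<^sup>2 - 4)"
  ultimately have "0 \<le> S"
    by simp
  then show ?thesis
    using assms unfolding v_def S_def[symmetric] by simp
qed

lemma v_root:
  assumes "t \<ge> 1"
  shows "1 / v t - 1 + v t = t"
proof -
  have "2\<^sup>2 \<le> (t + 1)\<^sup>2"
    using assms by (intro power_mono) auto
  then have "(sqrt ((t + 1)\<^sup>2 - 4))\<^sup>2 = (t + 1)\<^sup>2 - 4"
    by simp
  then have "1 + v t * v t = (t + 1) * v t"
    unfolding v_def by (simp add: field_simps power2_eq_square)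
  then show ?thesis
    using v_ge_1[OF assms] by (simp add: field_simps)
qed

text \<open>The hypothesis places \<open>x\<close> between the roots of x^2 - (t + 1) x + 1;
  completing the square bounds it by the larger root.\<close>

lemma le_v:
  assumes "1 - x + x\<^sup>2 \<le> t * x"
  shows "x \<le> v t"
proof -
  have "(2 * x - (t + 1))\<^sup>2 \<le> (t + 1)\<^sup>2 - 4"
    using assms by (simp add: power2_eq_square algebra_simps)
  then have "2 * x - (t + 1) \<le> sqrt ((t + 1)\<^sup>2 - 4)"
    by (rule real_le_rsqrt)
  then show ?thesis
    by (simp add: v_def field_simps)
qed

text \<open>Only countably many almost sure inequalities can be combined; density of the rationals
  then gives every real parameter pointwise, including a random one.\<close>

lemma continuous_nonneg_of_Rats:
  fixes f :: "real \<Rightarrow> real"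
  assumes "continuous_on UNIV f" "\<And>r. r \<in> \<rat> \<Longrightarrow> 0 \<le> f r"
  shows "0 \<le> f x"
proof -
  have "closed {x. 0 \<le> f x}"
    using assms(1) by (intro closed_Collect_le continuous_intros)
  then have "closure \<rat> \<subseteq> {x. 0 \<le> f x}"
    using assms(2) by (intro closure_minimal) auto
  then show ?thesis
    by (auto simp: Rats_closure_real)
qed

section \<open>Conditional moment inequalities with values in [0, \<infinity>]\<close>

context sigma_finite_subalgebra
begin

lemma nn_cond_exp_affine:
  assumes [measurable]: "f \<in> borel_measurable M" "g \<in> borel_measurable M"
  shows "AE x in M. nn_cond_exp M F (\<lambda>x. a * f x + b * g x + c) x
    = a * nn_cond_exp M F f x + b * nn_cond_exp M F g x + c"
proof -
  have "AE x in M. a * nn_cond_exp M F f x = nn_cond_exp M F (\<lambda>x. a * f x) x"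
    "AE x in M. b * nn_cond_exp M F g x = nn_cond_exp M F (\<lambda>x. b * g x) x"
    by (rule nn_cond_exp_prod; measurable)+
  moreover have "AE x in M. c = nn_cond_exp M F (\<lambda>x. c) x"
    by (rule nn_cond_exp_F_meas) simp
  moreover have "AE x in M. nn_cond_exp M F (\<lambda>x. a * f x) x + nn_cond_exp M F (\<lambda>x. b * g x) x
      = nn_cond_exp M F (\<lambda>x. a * f x + b * g x) x"
    by (rule nn_cond_exp_sum; measurable)
  moreover have "AE x in M. nn_cond_exp M F (\<lambda>x. a * f x + b * g x) x + nn_cond_exp M F (\<lambda>x. c) x
      = nn_cond_exp M F (\<lambda>x. a * f x + b * g x + c) x"
    by (rule nn_cond_exp_sum; measurable)
  ultimately show ?thesis
    by eventually_elim simp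
qed

lemma nn_cond_exp_affine_mono:
  assumes [measurable]: "f \<in> borel_measurable M" "g \<in> borel_measurable M"
      "f' \<in> borel_measurable M" "g' \<in> borel_measurable M"
    and "AE x in M. a * f x + b * g x + c \<le> a' * f' x + b' * g' x + c'"
  shows "AE x in M. a * nn_cond_exp M F f x + b * nn_cond_exp M F g x + c
    \<le> a' * nn_cond_exp M F f' x + b' * nn_cond_exp M F g' x + c'"
proof -
  have "AE x in M. nn_cond_exp M F (\<lambda>x. a * f x + b * g x + c) x
      \<le> nn_cond_exp M F (\<lambda>x. a' * f' x + b' * g' x + c') x"
    using assms(5) by (rule nn_cond_exp_mono; measurable)
  then show ?thesis
    using nn_cond_exp_affine[OF assms(1,2), of a b c] nn_cond_exp_affine[OF assms(3,4), of a' b' c']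
    by eventually_elim simp
qed

text \<open>\<open>ennreal\<close> truncates at 0, so these are the conditional expectations of the
  positive and negative parts of \<open>X\<close>. Integrability makes both finite almost
  everywhere, and then their difference \<open>real_cond_exp\<close> vanishes only if they
  agree.\<close>

lemma nn_cond_exp_pos_neg_eq:
  assumes X: "integrable M X" and mean: "AE x in M. real_cond_exp M F X x = 0"
  shows "AE x in M. nn_cond_exp M F (\<lambda>x. ennreal (X x)) x = nn_cond_exp M F (\<lambda>x. ennreal (- X x)) x
    \<and> nn_cond_exp M F (\<lambda>x. ennreal (X x)) x < \<infinity>"
proof -
  have fin: "AE x in M. nn_cond_exp M F (\<lambda>x. ennreal (Y x)) x \<noteq> \<infinity>" if Y: "integrable M Y" for Y
  proof (rule nn_integral_noteq_infinite)
    have [measurable]: "Y \<in> borel_measurable M"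
      using Y by simp
    show "nn_cond_exp M F (\<lambda>x. ennreal (Y x)) \<in> borel_measurable M"
      by simp
    have "(\<integral>\<^sup>+x. nn_cond_exp M F (\<lambda>x. ennreal (Y x)) x \<partial>M) = (\<integral>\<^sup>+x. ennreal (Y x) \<partial>M)"
      using nn_cond_exp_intg[of "\<lambda>_. 1" "\<lambda>x. ennreal (Y x)"] by simp
    then show "(\<integral>\<^sup>+x. nn_cond_exp M F (\<lambda>x. ennreal (Y x)) x \<partial>M) \<noteq> \<infinity>"
      using Y by (simp add: real_integrable_def)
  qed
  have "integrable M (\<lambda>x. - X x)"
    using X by simp
  from fin[OF X] fin[OF this] mean show ?thesis
  proof eventually_elim
    case (elim x)
    then show ?case
      unfolding real_cond_exp_def
      by (cases "nn_cond_exp M F (\<lambda>x. ennreal (X x)) x"; cases "nn_cond_exp M F (\<lambda>x. ennreal (- X x)) x") auto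
  qed
qed

text \<open>This is (X^2 - r)^2 \<ge> 0, linear in the moments for a fixed \<open>r\<close>. Taking
  \<open>r\<close> to be the conditional variance later yields that the conditional kurtosis is at
  least 1.\<close>

lemma nn_cond_exp_fourth_moment_ge_square:
  assumes [measurable]: "X \<in> borel_measurable M" and "r \<ge> 0"
  shows "AE x in M. ennreal (2 * r) * nn_cond_exp M F (\<lambda>x. ennreal (X x ^ 2)) x
    \<le> nn_cond_exp M F (\<lambda>x. ennreal (X x ^ 4)) x + ennreal (r\<^sup>2)"
proof -
  have "ennreal (2 * r) * ennreal (y ^ 2) \<le> ennreal (y ^ 4) + ennreal (r\<^sup>2)" for y :: real
  proof -
    have "0 \<le> (y\<^sup>2 - r)\<^sup>2"
      by simp
    then have "2 * r * y\<^sup>2 \<le> y ^ 4 + r\<^sup>2"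
      by (simp add: power2_eq_square power4_eq_xxxx algebra_simps)
    then show ?thesis
      using \<open>r \<ge> 0\<close> by (simp add: ennreal_mult[symmetric] ennreal_plus[symmetric] del: ennreal_plus)
  qed
  then show ?thesis
    using nn_cond_exp_affine_mono[of "\<lambda>x. ennreal (X x ^ 2)" "\<lambda>_. 0" "\<lambda>x. ennreal (X x ^ 4)" "\<lambda>_. 0"
        "ennreal (2 * r)" 0 0 1 0 "ennreal (r\<^sup>2)"] by simp
qed

text \<open>The coefficients come from $(X + r)^2 (1 - X) (2r - 1 - X) \ge 0$, whose factors make
  the cubic term cancel.\<close>

lemma nn_cond_exp_fourth_moment_ge:
  assumes X: "integrable M X" and mean: "AE x in M. real_cond_exp M F X x = 0"
    and le: "AE x in M. X x \<le> 1" and "r \<ge> 1"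
  shows "AE x in M. ennreal (3 * r\<^sup>2 - 2 * r + 1) * nn_cond_exp M F (\<lambda>x. ennreal (X x ^ 2)) x
    \<le> nn_cond_exp M F (\<lambda>x. ennreal (X x ^ 4)) x + ennreal (r\<^sup>2 * (2 * r - 1))"
proof -
  have [measurable]: "X \<in> borel_measurable M"
    using X by simp
  \<comment> \<open>Minus the coefficient of \<open>y\<close> in the expanded product.\<close>
  define c where "c = 2 * r * (r - 1)\<^sup>2"
  have c: "c \<ge> 0"
    using \<open>r \<ge> 1\<close> by (simp add: c_def)
  \<comment> \<open>There is no usable subtraction in [0, \<infinity>], so the linear term is split:
    the positive part of \<open>y\<close> stays on the left, the negative part goes to the right.
    Their conditional expectations coincide and cancel at the end.\<close>
  have *: "ennreal (3 * r\<^sup>2 - 2 * r + 1) * ennreal (y ^ 2) + ennreal c * ennreal y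
      \<le> ennreal (y ^ 4) + ennreal c * ennreal (- y) + ennreal (r\<^sup>2 * (2 * r - 1))" if "y \<le> 1" for y
  proof -
    have "0 \<le> (y + r)\<^sup>2 * ((1 - y) * (2 * r - 1 - y))"
      using that \<open>r \<ge> 1\<close> by (intro mult_nonneg_nonneg) auto
    also have "\<dots> = y ^ 4 + r\<^sup>2 * (2 * r - 1) - c * y - (3 * r\<^sup>2 - 2 * r + 1) * y\<^sup>2"
      unfolding c_def by algebra
    finally have *: "(3 * r\<^sup>2 - 2 * r + 1) * y\<^sup>2 + c * y \<le> y ^ 4 + r\<^sup>2 * (2 * r - 1)"
      by simp
    define p q where "p = max 0 y" and "q = max 0 (- y)"
    then have pq: "ennreal y = ennreal p" "ennreal (- y) = ennreal q" "0 \<le> p" "0 \<le> q" "y = p - q"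
      by (simp_all add: max_def ennreal_neg)
    have "(3 * r\<^sup>2 - 2 * r + 1) * y\<^sup>2 + c * p \<le> y ^ 4 + c * q + r\<^sup>2 * (2 * r - 1)"
      using * arg_cong[OF pq(5), of "(*) c"] by (simp add: right_diff_distrib)
    moreover have "0 \<le> 2 * r\<^sup>2 + (r - 1)\<^sup>2"
      by simp
    then have "0 \<le> 3 * r\<^sup>2 - 2 * r + 1"
      by (simp add: power2_eq_square algebra_simps)
    ultimately show ?thesis
      unfolding pq(1,2) using \<open>r \<ge> 1\<close> c pq(3,4)
      by (simp add: ennreal_mult[symmetric] ennreal_plus[symmetric] del: ennreal_plus)
  qed
  have "AE x in M. ennreal (3 * r\<^sup>2 - 2 * r + 1) * ennreal (X x ^ 2) + ennreal c * ennreal (X x) + 0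
      \<le> 1 * ennreal (X x ^ 4) + ennreal c * ennreal (- X x) + ennreal (r\<^sup>2 * (2 * r - 1))"
    using le by eventually_elim (simp add: *)
  then have "AE x in M. ennreal (3 * r\<^sup>2 - 2 * r + 1) * nn_cond_exp M F (\<lambda>x. ennreal (X x ^ 2)) x
        + ennreal c * nn_cond_exp M F (\<lambda>x. ennreal (X x)) x + 0
      \<le> 1 * nn_cond_exp M F (\<lambda>x. ennreal (X x ^ 4)) x + ennreal c * nn_cond_exp M F (\<lambda>x. ennreal (- X x)) x
        + ennreal (r\<^sup>2 * (2 * r - 1))"
    by (intro nn_cond_exp_affine_mono) measurable
  then show ?thesis
    using nn_cond_exp_pos_neg_eq[OF X mean]
  proof eventually_elim
    case (elim x)
    let ?t = "ennreal c * nn_cond_exp M F (\<lambda>x. ennreal (X x)) x"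
    \<comment> \<open>Cancelling a summand in [0, \<infinity>] is sound only when it is
      finite.\<close>
    have "?t < \<infinity>"
      using elim(2)[THEN conjunct2] by (simp add: ennreal_mult_less_top)
    moreover have "?t + ennreal (3 * r\<^sup>2 - 2 * r + 1) * nn_cond_exp M F (\<lambda>x. ennreal (X x ^ 2)) x
        \<le> ?t + (nn_cond_exp M F (\<lambda>x. ennreal (X x ^ 4)) x + ennreal (r\<^sup>2 * (2 * r - 1)))"
      using elim(1) elim(2)[THEN conjunct1] by (simp only: add_0_left add_0_right mult_1_left add.assoc add.commute add.left_commute)
    ultimately show ?case
      by (metis ennreal_add_left_cancel_le less_irrefl)
  qed
qed

text \<open>The moment inequalities hold almost surely for all rational parameters at once, hence by continuity
  also with the parameter equal to the (random) conditional variance.\<close>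

lemma cond_variance_le_of_cond_kurtosis:
  assumes X: "integrable M X" and mean: "AE x in M. real_cond_exp M F X x = 0"
    and le: "AE x in M. X x \<le> 1"
    and var: "AE x in M. cond_variance M F X x < \<infinity>"
    and kurt: "AE x in M. cond_kurtosis M F X x \<le> ennreal k"
  shows "AE x in M. 1 \<le> k \<and> cond_variance M F X x \<le> ennreal (v k)"
proof -
  let ?U = "nn_cond_exp M F (\<lambda>x. ennreal (X x ^ 2))" and ?W = "nn_cond_exp M F (\<lambda>x. ennreal (X x ^ 4))"
  \<comment> \<open>Clamping the parameter by \<open>max 0 r\<close>, and below by
    \<open>max 1 r\<close>, makes the inequality valid for every rational \<open>r\<close> while
    keeping it continuous in \<open>r\<close> on the whole line.\<close>
  have "AE x in M. \<forall>r\<in>\<rat>. ennreal (2 * max 0 r) * ?U x \<le> ?W x + ennreal ((max 0 r)\<^sup>2)"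
    using X by (intro AE_ball_countable[THEN iffD2, OF countable_rat] ballI nn_cond_exp_fourth_moment_ge_square) auto
  moreover have "AE x in M. \<forall>r\<in>\<rat>. ennreal (3 * (max 1 r)\<^sup>2 - 2 * max 1 r + 1) * ?U x
      \<le> ?W x + ennreal ((max 1 r)\<^sup>2 * (2 * max 1 r - 1))"
    by (intro AE_ball_countable[THEN iffD2, OF countable_rat] ballI nn_cond_exp_fourth_moment_ge[OF X mean le]) auto
  ultimately show ?thesis
    using var kurt
  proof eventually_elim
    case (elim x)
    show ?case
    proof (cases "?U x = 0")
      case True
      then have "1 \<le> k"
        using elim(4) by (simp add: cond_kurtosis_def cond_variance_def ennreal_1[symmetric] ennreal_le_iff2 del: ennreal_1)
      then show ?thesis
        using True by (simp add: cond_variance_def)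
    next
      case False
      obtain u where u: "?U x = ennreal u" "0 \<le> u"
        using elim(3) by (cases "?U x") (auto simp: cond_variance_def)
      then have "u > 0"
        using False by (cases "u = 0") auto
      have quot: "?W x / ennreal (u\<^sup>2) \<le> ennreal k"
        using elim(4) False u by (simp add: cond_kurtosis_def cond_variance_def ennreal_power)
      then have "?W x \<noteq> \<infinity>"
        by (auto simp: ennreal_top_divide top_unique)
      then obtain w where w: "?W x = ennreal w" "0 \<le> w"
        by (cases "?W x") auto
      \<comment> \<open>The second alternative covers a negative \<open>k\<close>, which
        \<open>ennreal\<close> turns into 0. It is excluded once the quotient is known to be at
        least 1.\<close>
      have k: "w / u\<^sup>2 \<le> k \<or> w / u\<^sup>2 \<le> 0"
        using quot w \<open>u > 0\<close> by (auto simp: divide_ennreal ennreal_le_iff2)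
      have "0 \<le> w + (max 0 r)\<^sup>2 - 2 * max 0 r * u" for r
      proof (rule continuous_nonneg_of_Rats[where f="\<lambda>r. w + (max 0 r)\<^sup>2 - 2 * max 0 r * u"])
        fix r :: real
        assume "r \<in> \<rat>"
        then have "ennreal (2 * max 0 r) * ennreal u \<le> ennreal w + ennreal ((max 0 r)\<^sup>2)"
          using elim(1) u w by auto
        then show "0 \<le> w + (max 0 r)\<^sup>2 - 2 * max 0 r * u"
          using u w by (simp add: ennreal_mult[symmetric] ennreal_plus[symmetric] del: ennreal_plus)
      qed (intro continuous_intros)
      from this[of u] have "u\<^sup>2 \<le> w"
        using \<open>u > 0\<close> by (simp add: power2_eq_square)
      then have "1 \<le> w / u\<^sup>2"
        using \<open>u > 0\<close> by simp
      with k have "1 \<le> k" "w / u\<^sup>2 \<le> k"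
        by linarith+
      then have wk: "w \<le> k * u\<^sup>2"
        using \<open>u > 0\<close> by (simp add: pos_divide_le_eq)
      have "u \<le> v k"
      \<comment> \<open>The sharper moment inequality admits only parameters at least 1, so it can
        be used at \<open>r = u\<close> only for \<open>u\<close> > 1; for smaller \<open>u\<close>
        the bound \<open>v k\<close> \<ge> 1 suffices.\<close>
      proof (cases "u \<le> 1")
        case True
        then show ?thesis
          using v_ge_1[OF \<open>1 \<le> k\<close>] by simp
      next
        case False
        have "0 \<le> w + (max 1 r)\<^sup>2 * (2 * max 1 r - 1) - (3 * (max 1 r)\<^sup>2 - 2 * max 1 r + 1) * u" for r
        proof (rule continuous_nonneg_of_Rats[where
              f="\<lambda>r. w + (max 1 r)\<^sup>2 * (2 * max 1 r - 1) - (3 * (max 1 r)\<^sup>2 - 2 * max 1 r + 1) * u"])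
          fix r :: real
          assume "r \<in> \<rat>"
          moreover define s where "s = max 1 r"
          ultimately have "ennreal (3 * s\<^sup>2 - 2 * s + 1) * ennreal u \<le> ennreal w + ennreal (s\<^sup>2 * (2 * s - 1))"
            using elim(2) u w by auto
          moreover have "1 \<le> s"
            by (simp add: s_def)
          moreover have "0 \<le> 2 * s\<^sup>2 + (s - 1)\<^sup>2"
            by simp
          then have "0 \<le> 3 * s\<^sup>2 - 2 * s + 1"
            by (simp add: power2_eq_square algebra_simps)
          ultimately show "0 \<le> w + (max 1 r)\<^sup>2 * (2 * max 1 r - 1) - (3 * (max 1 r)\<^sup>2 - 2 * max 1 r + 1) * u"
            unfolding s_def[symmetric] using u w
            by (simp add: ennreal_mult[symmetric] ennreal_plus[symmetric] del: ennreal_plus)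
        qed (intro continuous_intros)
        from this[of u] have "(3 * u\<^sup>2 - 2 * u + 1) * u \<le> w + u\<^sup>2 * (2 * u - 1)"
          using False by (simp add: max_def)
        \<comment> \<open>At \<open>r = u\<close> the inequality reads u^3 - u^2 + u \<le> w;
          combined with w \<le> k u^2 and divided by \<open>u\<close> it is the hypothesis of
          \<open>le_v\<close>.\<close>
        then have "u * (1 - u + u\<^sup>2) \<le> u * (k * u)"
          using wk by (simp add: power2_eq_square algebra_simps)
        then show ?thesis
          using \<open>u > 0\<close> by (intro le_v) simp
      qed
      then show ?thesis
        using \<open>1 \<le> k\<close> u by (simp add: cond_variance_def ennreal_leI)
    qed
  qed
qed

end

subsection \<open>Comparison with sums of independent Bernoulli variables\<close>

lemma borel_measurable_smooth_payoff:
  assumes "smooth_payoff g g'"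
  shows "g \<in> borel_measurable borel" "g' \<in> borel_measurable borel"
proof -
  have "continuous_on UNIV g"
    using assms by (meson smooth_payoff_def DERIV_continuous continuous_at_imp_continuous_on)
  then show "g \<in> borel_measurable borel"
    by (rule borel_measurable_continuous_onI)
  show "g' \<in> borel_measurable borel"
    using assms by (simp add: smooth_payoff_def borel_measurable_mono)
qed

lemma smooth_payoff_mono:
  assumes "smooth_payoff g g'" "x \<le> y"
  shows "g x \<le> g y"
  by (rule mono_between[where f=g and f'=g']) (use assms in \<open>auto simp: smooth_payoff_def\<close>)

lemma integrable_bounded_mult:
  fixes f X :: "'a \<Rightarrow> real"
  assumes [measurable]: "f \<in> borel_measurable M" and X: "integrable M X"
    and f: "AE x in M. 0 \<le> f x \<and> f x \<le> C"
  shows "integrable M (\<lambda>x. f x * X x)"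
proof (rule Bochner_Integration.integrable_bound)
  show "integrable M (\<lambda>x. C * X x)"
    using X by simp
  show "AE x in M. norm (f x * X x) \<le> norm (C * X x)"
    using f by eventually_elim (auto simp: abs_mult intro!: mult_right_mono)
qed (use X in measurable)

text \<open>Integrate the parabola of \<open>bern_one_step\<close> with the past value
  \<open>Y\<close> in place of \<open>y\<close>. Its coefficients are measurable with respect to
  \<open>F\<close> and bounded, as \<open>Y\<close> is bounded above and \<open>g\<close>,
  \<open>g'\<close> are nonnegative and increasing. The linear term in \<open>X\<close> then
  integrates to 0, and the quadratic one is controlled by \<open>s\<close> because \<open>z\<close>
  is nonnegative.\<close>

lemma (in finite_measure_subalgebra) integral_payoff_step:
  fixes X Y :: "'a \<Rightarrow> real"
  assumes Y[measurable]: "Y \<in> borel_measurable F" and YK: "AE x in M. Y x \<le> K"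
    and X: "integrable M X" and mean: "AE x in M. real_cond_exp M F X x = 0"
    and le: "AE x in M. X x \<le> 1"
    and var: "AE x in M. cond_variance M F X x \<le> ennreal s" and s: "s > 0"
    and g: "smooth_payoff g g'"
  shows "(\<integral>x. g (Y x + X x) \<partial>M) \<le> (\<integral>x. bern s g (Y x) \<partial>M)"
proof -
  have [measurable]: "X \<in> borel_measurable M"
    using X by simp
  have [measurable]: "Y \<in> borel_measurable M"
    by (rule measurable_from_subalg[OF subalg Y])
  note [measurable] = borel_measurable_smooth_payoff[OF g]
  define a where "a = (\<lambda>x. g (Y x - s))"
  define b where "b = (\<lambda>x. g' (Y x - s))"
  define z where "z = (\<lambda>x. (g (Y x + 1) - g (Y x - s) - g' (Y x - s) * (1 + s)) / (1 + s)\<^sup>2)"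
  \<comment> \<open>The coefficient of \<open>X\<close> after expanding the parabola in powers of
    \<open>X\<close> instead of \<open>X + s\<close>.\<close>
  define B where "B = (\<lambda>x. b x + 2 * s * z x)"
  have [measurable]: "z \<in> borel_measurable F" "B \<in> borel_measurable F"
    unfolding z_def B_def b_def by measurable
  have [measurable]: "a \<in> borel_measurable M" "b \<in> borel_measurable M" "z \<in> borel_measurable M" "B \<in> borel_measurable M"
    unfolding a_def z_def B_def b_def by measurable
  have a_bd: "AE x in M. 0 \<le> a x \<and> a x \<le> g (K - s)"
    using YK by eventually_elim (use g smooth_payoff_mono[OF g] in \<open>auto simp: a_def smooth_payoff_def\<close>)
  have b_bd: "AE x in M. 0 \<le> b x \<and> b x \<le> g' (K - s)"
    using YK by eventually_elim (use g in \<open>auto simp: b_def smooth_payoff_def mono_def\<close>)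
  have z_nonneg: "0 \<le> z x" for x
    using bern_one_step(2)[OF g s order_refl] by (simp add: z_def)
  have z_bd: "AE x in M. 0 \<le> z x \<and> z x \<le> g (K + 1) / (1 + s)\<^sup>2"
    using YK
  proof eventually_elim
    case (elim x)
    have "z x \<le> g (Y x + 1) / (1 + s)\<^sup>2"
      using bern_one_step(3)[OF g s order_refl] by (simp add: z_def)
    also have "\<dots> \<le> g (K + 1) / (1 + s)\<^sup>2"
      using elim by (intro divide_right_mono smooth_payoff_mono[OF g]) auto
    finally show ?case
      using z_nonneg by simp
  qed
  have B_bd: "AE x in M. 0 \<le> B x \<and> B x \<le> g' (K - s) + 2 * s * (g (K + 1) / (1 + s)\<^sup>2)"
    using b_bd z_bd
  proof eventually_elim
    case (elim x)
    then have "2 * s * z x \<le> 2 * s * (g (K + 1) / (1 + s)\<^sup>2)" "0 \<le> 2 * s * z x"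
      using s by (intro mult_left_mono mult_nonneg_nonneg; simp)+
    then show ?case
      using elim unfolding B_def by (intro conjI add_mono add_nonneg_nonneg) auto
  qed
  have bounded: "integrable M f" if "f \<in> borel_measurable M" "AE x in M. 0 \<le> f x \<and> f x \<le> C" for f :: "'a \<Rightarrow> real" and C
    using integrable_bounded_mult[OF that(1), of "\<lambda>_. 1" C] that(2) by simp
  have ia: "integrable M a" and ib: "integrable M b" and iz: "integrable M z"
    using bounded[OF _ a_bd] bounded[OF _ b_bd] bounded[OF _ z_bd] by auto
  have X2: "integrable M (\<lambda>x. (X x)\<^sup>2)"
  proof (rule integrableI_nonneg)
    have "(\<integral>\<^sup>+x. ennreal ((X x)\<^sup>2) \<partial>M) = (\<integral>\<^sup>+x. cond_variance M F X x \<partial>M)"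
      using nn_cond_exp_intg[of "\<lambda>_. 1" "\<lambda>x. ennreal ((X x)\<^sup>2)"] by (simp add: cond_variance_def)
    also have "\<dots> \<le> (\<integral>\<^sup>+x. ennreal s \<partial>M)"
      by (intro nn_integral_mono_AE var)
    also have "\<dots> < \<infinity>"
      by (simp add: ennreal_mult_eq_top_iff less_top[symmetric])
    finally show "(\<integral>\<^sup>+x. ennreal ((X x)\<^sup>2) \<partial>M) < \<infinity>" .
  qed auto
  have iBX: "integrable M (\<lambda>x. B x * X x)"
    by (intro integrable_bounded_mult[OF _ X B_bd]) measurable
  have izX: "integrable M (\<lambda>x. z x * (X x)\<^sup>2)"
    by (intro integrable_bounded_mult[OF _ X2 z_bd]) measurable
  have BX: "(\<integral>x. B x * X x \<partial>M) = 0"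
  proof -
    have "(\<integral>x. B x * X x \<partial>M) = (\<integral>x. B x * real_cond_exp M F X x \<partial>M)"
      by (rule real_cond_exp_intg(2)[symmetric, OF iBX]) measurable
    also have "\<dots> = (\<integral>x. 0 \<partial>M)"
      using mean by (intro integral_cong_AE) auto
    finally show ?thesis by simp
  qed
  \<comment> \<open>The \<open>F\<close>-measurable factor is moved past the conditional expectation
    in its nonnegative form, because the conditional variance is a value in
    [0, \<infinity>].\<close>
  have zX: "(\<integral>x. z x * (X x)\<^sup>2 \<partial>M) \<le> (\<integral>x. z x * s \<partial>M)"
  proof -
    have "ennreal (\<integral>x. z x * (X x)\<^sup>2 \<partial>M) = (\<integral>\<^sup>+x. ennreal (z x * (X x)\<^sup>2) \<partial>M)"
      using izX z_nonneg by (intro nn_integral_eq_integral[symmetric]) auto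
    also have "\<dots> = (\<integral>\<^sup>+x. ennreal (z x) * cond_variance M F X x \<partial>M)"
      using z_nonneg nn_cond_exp_intg[of "\<lambda>x. ennreal (z x)" "\<lambda>x. ennreal ((X x)\<^sup>2)"]
      by (simp add: cond_variance_def ennreal_mult)
    also have "\<dots> \<le> (\<integral>\<^sup>+x. ennreal (z x) * ennreal s \<partial>M)"
      using var by (intro nn_integral_mono_AE) (auto intro!: mult_left_mono)
    also have "\<dots> = (\<integral>\<^sup>+x. ennreal (z x * s) \<partial>M)"
      using z_nonneg s by (simp add: ennreal_mult)
    also have "\<dots> = ennreal (\<integral>x. z x * s \<partial>M)"
      using iz z_nonneg s by (intro nn_integral_eq_integral) auto
    finally show ?thesis
      using z_nonneg s by (subst (asm) ennreal_le_iff) auto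
  qed
  have "(\<integral>x. g (Y x + X x) \<partial>M) \<le> (\<integral>x. (a x + b x * s + z x * s\<^sup>2) + B x * X x + z x * (X x)\<^sup>2 \<partial>M)"
  proof (rule integral_mono_AE)
    have "AE x in M. 0 \<le> g (Y x + X x) \<and> g (Y x + X x) \<le> g (K + 1)"
      using YK le by eventually_elim (use g in \<open>auto simp: smooth_payoff_def intro!: smooth_payoff_mono[OF g]\<close>)
    then show "integrable M (\<lambda>x. g (Y x + X x))"
      by (intro bounded) measurable
    show "integrable M (\<lambda>x. (a x + b x * s + z x * s\<^sup>2) + B x * X x + z x * (X x)\<^sup>2)"
      using ia ib iz iBX izX by auto
    show "AE x in M. g (Y x + X x) \<le> (a x + b x * s + z x * s\<^sup>2) + B x * X x + z x * (X x)\<^sup>2"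
      using le
    proof eventually_elim
      case (elim x)
      have "g (Y x + X x) \<le> a x + b x * (X x + s) + z x * (X x + s)\<^sup>2"
        using bern_one_step(1)[OF g s elim, of "Y x"] by (simp add: a_def b_def z_def)
      also have "\<dots> = (a x + b x * s + z x * s\<^sup>2) + B x * X x + z x * (X x)\<^sup>2"
        unfolding B_def by algebra
      finally show ?case .
    qed
  qed
  also have "\<dots> = (\<integral>x. a x + b x * s + z x * s\<^sup>2 \<partial>M) + (\<integral>x. z x * (X x)\<^sup>2 \<partial>M)"
    using ia ib iz iBX izX BX by simp
  also have "\<dots> \<le> (\<integral>x. a x + b x * s + z x * s\<^sup>2 \<partial>M) + (\<integral>x. z x * s \<partial>M)"
    using zX by simp
  also have "\<dots> = (\<integral>x. (a x + b x * s + z x * s\<^sup>2) + z x * s \<partial>M)"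
    using ia ib iz by (intro Bochner_Integration.integral_add[symmetric]) auto
  also have "\<dots> = (\<integral>x. bern s g (Y x) \<partial>M)"
  proof (rule Bochner_Integration.integral_cong[OF refl])
    fix x
    show "a x + b x * s + z x * s\<^sup>2 + z x * s = bern s g (Y x)"
      using bern_one_step(4)[OF g s order_refl, of "Y x"] by (simp add: a_def b_def z_def distrib_left)
  qed
  finally show ?thesis .
qed

lemma finite_measure_subalgebra_of_prob_space:
  "prob_space P \<Longrightarrow> subalgebra P G \<Longrightarrow> finite_measure_subalgebra P G"
  by (simp add: finite_measure_subalgebra_def finite_measure_subalgebra_axioms_def prob_space.finite_measure)

lemma martingale_upto_differences:
  assumes P: "prob_space P" and M: "M = (\<lambda>k \<omega>. \<Sum>i=1..k. X i \<omega>)" and mart: "martingale_upto P F M n"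
    and k: "k \<in> {1..n}"
  shows "integrable P (X k)" "AE \<omega> in P. real_cond_exp P (F (k - 1)) (X k) \<omega> = 0"
proof -
  have sub: "subalgebra P (F (k - 1))"
    using mart k by (auto simp: martingale_upto_def filtration_upto_def)
  interpret finite_measure_subalgebra P "F (k - 1)"
    by (rule finite_measure_subalgebra_of_prob_space[OF P sub])
  have X: "X k = (\<lambda>\<omega>. M k \<omega> - M (k - 1) \<omega>)"
    using k by (cases k) (auto simp: M)
  have iM: "integrable P (M k)" "integrable P (M (k - 1))" and mM: "M (k - 1) \<in> borel_measurable (F (k - 1))"
    using mart k by (auto simp: martingale_upto_def)
  then show "integrable P (X k)"
    unfolding X by simp
  have "AE \<omega> in P. real_cond_exp P (F (k - 1)) (M k) \<omega> = M (k - 1) \<omega>"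
    using mart k unfolding martingale_upto_def by (metis atLeastAtMost_iff diff_le_self)
  with real_cond_exp_diff[OF iM] real_cond_exp_F_meas[OF iM(2) mM]
  show "AE \<omega> in P. real_cond_exp P (F (k - 1)) (X k) \<omega> = 0"
    unfolding X by eventually_elim simp
qed

lemma AE_sum_le_of_AE_le_1:
  assumes "\<forall>k\<in>{1..n}. AE \<omega> in P. X k \<omega> \<le> (1::real)" "j \<le> n"
  shows "AE \<omega> in P. (\<Sum>i=1..j. X i \<omega>) \<le> real j"
proof -
  have "AE \<omega> in P. \<forall>k\<in>{1..j}. X k \<omega> \<le> 1"
    using assms by (intro AE_finite_allI) auto
  then show ?thesis
  proof eventually_elim
    case (elim \<omega>)
    then show ?case
      using sum_bounded_above[of "{1..j}" "\<lambda>i. X i \<omega>" 1] by simp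
  qed
qed

text \<open>Induction on the time, peeling off the last increment: it is replaced by a Bernoulli
  step, and the averaged payoff \<open>bern (s (Suc j)) g\<close> is handed to the earlier times.
  The last variance thus acts first, which explains the reversed list.\<close>

lemma martingale_payoff_le:
  assumes P: "prob_space P" and M: "M = (\<lambda>k \<omega>. \<Sum>i=1..k. X i \<omega>)" and mart: "martingale_upto P F M n"
    and le: "\<forall>k\<in>{1..n}. AE \<omega> in P. X k \<omega> \<le> 1"
    and var: "\<And>k. k \<in> {1..n} \<Longrightarrow> AE \<omega> in P. cond_variance P (F (k - 1)) (X k) \<omega> \<le> ennreal (s k)"
    and s: "\<And>k. k \<in> {1..n} \<Longrightarrow> s k > 0"
    and g: "smooth_payoff g g'" and "j \<le> n"
  shows "(\<integral>\<omega>. g (M j \<omega>) \<partial>P) \<le> fold bern (map s (rev [1..<Suc j])) g 0"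
  using g \<open>j \<le> n\<close>
proof (induction j arbitrary: g g')
  case 0
  interpret prob_space P by (rule P)
  show ?case
    by (simp add: M prob_space)
next
  case (Suc j)
  then have sub: "subalgebra P (F j)" and mM: "M j \<in> borel_measurable (F j)"
    using mart by (auto simp: martingale_upto_def filtration_upto_def)
  interpret finite_measure_subalgebra P "F j"
    by (rule finite_measure_subalgebra_of_prob_space[OF P sub])
  have k: "Suc j \<in> {1..n}"
    using Suc.prems by simp
  have "(\<integral>\<omega>. g (M (Suc j) \<omega>) \<partial>P) = (\<integral>\<omega>. g (M j \<omega> + X (Suc j) \<omega>) \<partial>P)"
    by (simp add: M)
  also have "\<dots> \<le> (\<integral>\<omega>. bern (s (Suc j)) g (M j \<omega>) \<partial>P)"
  proof (rule integral_payoff_step[OF mM])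
    show "AE \<omega> in P. M j \<omega> \<le> real j"
      using AE_sum_le_of_AE_le_1[OF le, of j] Suc.prems by (simp add: M)
  qed (use martingale_upto_differences[OF P M mart k] le var[OF k] s k Suc.prems in auto)
  also have "\<dots> \<le> fold bern (map s (rev [1..<Suc j])) (bern (s (Suc j)) g) 0"
    using Suc.prems s k by (intro Suc.IH[OF smooth_payoff_bern[OF Suc.prems(1)]]) auto
  also have "\<dots> = fold bern (map s (rev [1..<Suc (Suc j)])) g 0"
    by simp
  finally show ?case .
qed

section \<open>Expected payoffs of sums of independent Bernoulli variables\<close>

lemma expectation_bernoulli_law:
  assumes "s > 0"
  shows "(\<integral>y. f y \<partial>measure_pmf (bernoulli_law s)) = (f (- s) + s * f 1) / (1 + s :: real)"
proof -
  have "(\<integral>y. f y \<partial>measure_pmf (bernoulli_law s)) = s / (1 + s) * f 1 + (1 - s / (1 + s)) * f (- s)"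
    using assms by (simp add: bernoulli_law_def)
  also have "1 - s / (1 + s) = 1 / (1 + s)"
    using assms by (simp add: field_simps)
  finally show ?thesis
    by (simp add: add_divide_distrib)
qed

text \<open>The last summand takes only two values almost surely. Splitting along them turns the
  payoff into two products of an indicator and a shifted payoff of the earlier sum, and independence
  factors each. Integrability is carried through the same induction, since it is used for the
  shifted payoffs.\<close>

lemma indep_bernoulli_payoff:
  assumes "prob_space N" and Y: "prob_space.indep_vars N (\<lambda>_. borel) Y {1..n}"
    and law: "\<forall>k\<in>{1..n}. distr N borel (Y k) = distr (measure_pmf (bernoulli_law s)) borel (\<lambda>y. y)"
    and s: "s > 0" and "smooth_payoff g g'" "j \<le> n"
  shows "integrable N (\<lambda>\<omega>. g (\<Sum>k=1..j. Y k \<omega>)) \<and>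
    (\<integral>\<omega>. g (\<Sum>k=1..j. Y k \<omega>) \<partial>N) = fold bern (replicate j s) g 0"
  using \<open>smooth_payoff g g'\<close> \<open>j \<le> n\<close>
proof (induction j arbitrary: g g')
  case 0
  interpret prob_space N by fact
  show ?case
    by (simp add: prob_space)
next
  case (Suc j)
  interpret prob_space N by fact
  define S where "S = (\<lambda>\<omega>. \<Sum>k=1..j. Y k \<omega>)"
  define Z where "Z = Y (Suc j)"
  have rvY: "random_variable borel (Y k)" if "k \<in> {1..n}" for k
    using Y that by (simp add: indep_vars_def2)
  have [measurable]: "Z \<in> borel_measurable N" "S \<in> borel_measurable N"
    using rvY Suc.prems unfolding Z_def S_def by (auto intro!: borel_measurable_sum)
  \<comment> \<open>The index set must show the last variable separately for its independence from
    the sum of the others.\<close>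
  have "{1..Suc j} = insert (Suc j) {1..j}"
    by auto
  then have "indep_vars (\<lambda>_. borel) Y (insert (Suc j) {1..j})"
    using Y Suc.prems by (metis indep_vars_subset atLeastatMost_subset_iff order_refl)
  then have indep: "indep_var borel Z borel S"
    unfolding Z_def S_def by (intro indep_vars_sum) auto
  have lawZ: "distr N borel Z = distr (measure_pmf (bernoulli_law s)) borel (\<lambda>y. y)"
    using law Suc.prems by (simp add: Z_def)
  have "AE y in distr N borel Z. y \<in> {- s, 1}"
    unfolding lawZ using pmf_bernoulli_law(3)[OF s]
    by (subst AE_distr_iff) (auto simp: AE_measure_pmf_iff)
  then have Z: "AE \<omega> in N. Z \<omega> = - s \<or> Z \<omega> = 1"
    by (subst (asm) AE_distr_iff) auto
  have EZ: "(\<integral>\<omega>. indicator {c} (Z \<omega>) \<partial>N) = (indicator {c} (- s) + s * indicator {c} 1) / (1 + s :: real)" for c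
  proof -
    have "(\<integral>\<omega>. indicator {c} (Z \<omega>) \<partial>N) = (\<integral>y. (indicator {c} y :: real) \<partial>distr N borel Z)"
      by (rule integral_distr[symmetric]) auto
    also have "\<dots> = (\<integral>y. indicator {c} y \<partial>measure_pmf (bernoulli_law s))"
      unfolding lawZ by (rule integral_distr) auto
    finally show ?thesis
      unfolding expectation_bernoulli_law[OF s] .
  qed
  note [measurable] = borel_measurable_smooth_payoff[OF Suc.prems(1)]
  have prod: "integrable N (\<lambda>\<omega>. indicator {c} (Z \<omega>) * g (S \<omega> + c))"
      "(\<integral>\<omega>. indicator {c} (Z \<omega>) * g (S \<omega> + c) \<partial>N) = (\<integral>\<omega>. indicator {c} (Z \<omega>) \<partial>N) * (\<integral>\<omega>. g (S \<omega> + c) \<partial>N)" for c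
  proof -
    have "indep_var borel ((indicator {c} :: real \<Rightarrow> real) \<circ> Z) borel ((\<lambda>x. g (x + c)) \<circ> S)"
      by (rule indep_var_compose[OF indep]) measurable
    then have i: "indep_var borel (\<lambda>\<omega>. indicator {c} (Z \<omega>) :: real) borel (\<lambda>\<omega>. g (S \<omega> + c))"
      by (simp add: comp_def)
    have 1: "integrable N (\<lambda>\<omega>. indicator {c} (Z \<omega>) :: real)"
      by (rule integrable_const_bound[of _ 1]) (auto simp: indicator_def)
    have 2: "integrable N (\<lambda>\<omega>. g (S \<omega> + c))"
      using Suc.IH[OF smooth_payoff_shift[OF Suc.prems(1), of c]] Suc.prems by (simp add: S_def)
    show "integrable N (\<lambda>\<omega>. indicator {c} (Z \<omega>) * g (S \<omega> + c))"
      by (rule indep_var_integrable[OF i 1 2])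
    show "(\<integral>\<omega>. indicator {c} (Z \<omega>) * g (S \<omega> + c) \<partial>N) = (\<integral>\<omega>. indicator {c} (Z \<omega>) \<partial>N) * (\<integral>\<omega>. g (S \<omega> + c) \<partial>N)"
      by (rule indep_var_lebesgue_integral[OF i 1 2])
  qed
  have iS: "integrable N (\<lambda>\<omega>. g (S \<omega> + c))" for c
    using Suc.IH[OF smooth_payoff_shift[OF Suc.prems(1), of c]] Suc.prems by (simp add: S_def)
  let ?split = "\<lambda>\<omega>. indicator {- s} (Z \<omega>) * g (S \<omega> + - s) + indicator {1} (Z \<omega>) * g (S \<omega> + 1)"
  have sum: "(\<Sum>k=1..Suc j. Y k \<omega>) = S \<omega> + Z \<omega>" for \<omega>
    by (simp add: S_def Z_def)
  have AE: "AE \<omega> in N. g (S \<omega> + Z \<omega>) = ?split \<omega>"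
    using Z by eventually_elim (use s in \<open>auto simp: indicator_def\<close>)
  have "integrable N ?split"
    by (intro Bochner_Integration.integrable_add prod(1))
  then have "integrable N (\<lambda>\<omega>. g (S \<omega> + Z \<omega>))"
    by (subst integrable_cong_AE[OF _ _ AE]) measurable
  moreover have "(\<integral>\<omega>. g (S \<omega> + Z \<omega>) \<partial>N) = fold bern (replicate (Suc j) s) g 0"
  proof -
    have "(\<integral>\<omega>. g (S \<omega> + Z \<omega>) \<partial>N) = (\<integral>\<omega>. ?split \<omega> \<partial>N)"
      using AE by (intro integral_cong_AE) auto
    also have "\<dots> = 1 / (1 + s) * (\<integral>\<omega>. g (S \<omega> + - s) \<partial>N) + s / (1 + s) * (\<integral>\<omega>. g (S \<omega> + 1) \<partial>N)"
    proof -
      have "- s \<noteq> 1" "1 \<noteq> - s"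
        using s by auto
      then show ?thesis
        unfolding Bochner_Integration.integral_add[OF prod(1) prod(1)] prod(2) EZ by (simp add: indicator_def)
    qed
    also have "\<dots> = (\<integral>\<omega>. bern s g (S \<omega>) \<partial>N)"
      unfolding bern_combination using iS[of "- s"] iS[of 1] by simp
    also have "\<dots> = fold bern (replicate j s) (bern s g) 0"
      using Suc.IH[OF smooth_payoff_bern[OF Suc.prems(1) s]] Suc.prems by (simp add: S_def)
    finally show ?thesis
      by simp
  qed
  ultimately show ?case
    unfolding sum by blast
qed

lemma (in prob_space) prob_ge_le_payoff:
  assumes g: "smooth_payoff g g'" and i: "integrable M (\<lambda>\<omega>. g (Z \<omega>))"
    and [measurable]: "Z \<in> borel_measurable M" and "g x > 0"
  shows "prob {\<omega> \<in> space M. Z \<omega> \<ge> x} \<le> expectation (\<lambda>\<omega>. g (Z \<omega>)) / g x"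
proof -
  note [measurable] = borel_measurable_smooth_payoff[OF g]
  have "prob {\<omega> \<in> space M. Z \<omega> \<ge> x} \<le> prob {\<omega> \<in> space M. g (Z \<omega>) \<ge> g x}"
    using smooth_payoff_mono[OF g] by (intro finite_measure_mono) auto
  also have "\<dots> \<le> expectation (\<lambda>\<omega>. g (Z \<omega>)) / g x"
    using g \<open>g x > 0\<close> by (intro integral_Markov_inequality_measure[OF i]) (auto simp: smooth_payoff_def)
  finally show ?thesis .
qed

theorem theorem1p3:
  fixes P :: "'a measure"
    and F :: "nat \<Rightarrow> 'a measure"
    and X :: "nat \<Rightarrow> 'a \<Rightarrow> real"
    and M :: "nat \<Rightarrow> 'a \<Rightarrow> real"
    and n :: nat
    and \<kappa>s :: "nat \<Rightarrow> real"
    and \<sigma>2 \<kappa> :: real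
  assumes "prob_space P"
    and "n \<ge> 1"
    and "M = (\<lambda>k \<omega>. \<Sum>i=1..k. X i \<omega>)"
    and "martingale_upto P F M n"
    and "\<forall>k\<in>{1..n}. AE \<omega> in P. X k \<omega> \<le> 1"
    and "\<forall>k\<in>{1..n}. AE \<omega> in P. cond_variance P (F (k - 1)) (X k) \<omega> < \<infinity>"
    and "\<forall>k\<in>{1..n}. AE \<omega> in P. cond_kurtosis P (F (k - 1)) (X k) \<omega> \<le> ennreal (\<kappa>s k)"
    and "\<sigma>2 = (\<Sum>k=1..n. v (\<kappa>s k)) / real n"
    and "\<kappa> = 1 / \<sigma>2 - 1 + \<sigma>2"
  shows "(\<forall>k\<in>{1..n}. \<kappa>s k \<ge> 1) \<and> \<sigma>2 > 0
    \<and> prob_space.expectation (bernoulli_law \<sigma>2) (\<lambda>y. y) = 0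
    \<and> prob_space.variance (bernoulli_law \<sigma>2) (\<lambda>y. y) = \<sigma>2
    \<and> kurtosis (bernoulli_law \<sigma>2) (\<lambda>y. y) = \<kappa>
    \<and> (\<forall>(N :: 'b measure) Y T. indep_copies N Y n (bernoulli_law \<sigma>2) \<longrightarrow>
         T = (\<lambda>\<omega>. \<Sum>k=1..n. Y k \<omega>) \<longrightarrow>
         (\<forall>x::real.
            measure P {\<omega> \<in> space P. M n \<omega> \<ge> x}
              \<le> (INF h\<in>{0<..}. exp (- h * x) * prob_space.expectation N (\<lambda>\<omega>. exp (h * T \<omega>)))
          \<and> measure P {\<omega> \<in> space P. M n \<omega> \<ge> x}
              \<le> (INF h\<in>{..<x}. (x - h) powi (- 2)
                    * prob_space.expectation N (\<lambda>\<omega>. (max 0 (T \<omega> - h))\<^sup>2))))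
    \<and> (\<forall>c. (\<forall>k\<in>{1..n}. \<kappa>s k = c) \<longrightarrow>
         \<kappa> = c \<and> \<sigma>2 = v c
         \<and> kurtosis (bernoulli_law \<sigma>2) (\<lambda>y. y) = c
         \<and> prob_space.variance (bernoulli_law \<sigma>2) (\<lambda>y. y) = v c)"
proof -
  note P = assms(1) and n = assms(2) and M = assms(3) and mart = assms(4) and le = assms(5)
  interpret prob_space P by (rule P)
  have cond: "AE \<omega> in P. 1 \<le> \<kappa>s k \<and> cond_variance P (F (k - 1)) (X k) \<omega> \<le> ennreal (v (\<kappa>s k))"
    if k: "k \<in> {1..n}" for k
  proof -
    have sub: "subalgebra P (F (k - 1))"
      using mart k by (auto simp: martingale_upto_def filtration_upto_def)
    interpret G: finite_measure_subalgebra P "F (k - 1)"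
      by (rule finite_measure_subalgebra_of_prob_space[OF P sub])
    show ?thesis
      using martingale_upto_differences[OF P M mart k] le assms(6,7) k
      by (intro G.cond_variance_le_of_cond_kurtosis) auto
  qed
  have \<kappa>s: "\<kappa>s k \<ge> 1" if "k \<in> {1..n}" for k
  proof -
    have "AE \<omega> in P. 1 \<le> \<kappa>s k"
      using cond[OF that] by eventually_elim simp
    then show ?thesis
      by (simp add: AE_const)
  qed
  have v_pos: "v (\<kappa>s k) > 0" if "k \<in> {1..n}" for k
    using v_ge_1[OF \<kappa>s[OF that]] by simp
  have \<sigma>2: "\<sigma>2 > 0"
    unfolding assms(8) using n v_pos by (intro divide_pos_pos sum_pos) auto
  have mean: "prob_space.expectation (bernoulli_law \<sigma>2) (\<lambda>y. y) = 0"
    by (simp add: expectation_bernoulli_law[OF \<sigma>2])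
  have var: "prob_space.variance (bernoulli_law \<sigma>2) (\<lambda>y. y) = \<sigma>2"
  proof -
    have "\<sigma>2\<^sup>2 + \<sigma>2 = \<sigma>2 * (1 + \<sigma>2)"
      by algebra
    then show ?thesis
      using \<sigma>2 by (simp add: mean expectation_bernoulli_law[OF \<sigma>2])
  qed
  have kurt: "kurtosis (bernoulli_law \<sigma>2) (\<lambda>y. y) = \<kappa>"
  proof -
    \<comment> \<open>The fourth moment is this expression divided by \<open>1 + \<sigma>2\<close>,
      a factor that cancels by the sum of cubes formula.\<close>
    have "\<sigma>2 ^ 4 + \<sigma>2 = (1 - \<sigma>2 + \<sigma>2\<^sup>2) * \<sigma>2 * (1 + \<sigma>2)"
      by algebra
    then have "(\<integral>y. y ^ 4 \<partial>measure_pmf (bernoulli_law \<sigma>2)) = (1 - \<sigma>2 + \<sigma>2\<^sup>2) * \<sigma>2"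
      using \<sigma>2 by (simp add: expectation_bernoulli_law[OF \<sigma>2])
    then show ?thesis
      using \<sigma>2 unfolding kurtosis_def var assms(9) by (simp add: field_simps power2_eq_square)
  qed
  \<comment> \<open>In the reversed order produced by \<open>martingale_payoff_le\<close>.\<close>
  define xs where "xs = map (\<lambda>k. v (\<kappa>s k)) (rev [1..<Suc n])"
  have len: "length xs = n"
    by (simp add: xs_def)
  have xs_pos: "x > 0" if "x \<in> set xs" for x
    using that v_pos by (auto simp: xs_def)
  have "sum_list xs = (\<Sum>k=1..n. v (\<kappa>s k))"
    unfolding xs_def rev_map[symmetric] sum_list_rev
    by (simp add: interv_sum_list_conv_sum_set_nat atLeastLessThanSuc_atLeastAtMost del: upt_Suc)
  then have xs_sum: "sum_list xs = real (length xs) * \<sigma>2"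
    using n by (simp add: assms(8) len)
  have mM: "M n \<in> borel_measurable P"
    using mart by (auto simp: martingale_upto_def)
  \<comment> \<open>Markov's inequality, then replacement of the increments by Bernoulli steps, then
    equalization of the variances, for an arbitrary smooth payoff positive at
    \<open>x\<close>.\<close>
  have bound: "prob {\<omega> \<in> space P. M n \<omega> \<ge> x} \<le> (\<integral>\<omega>. g (\<Sum>k=1..n. Y k \<omega>) \<partial>N) / g x"
    if g: "smooth_payoff g g'" and "g x > 0" and Y: "indep_copies N Y n (bernoulli_law \<sigma>2)"
    for g g' x and N :: "'b measure" and Y
  proof -
    note [measurable] = mM borel_measurable_smooth_payoff[OF g]
    have "AE \<omega> in P. M n \<omega> \<le> real n"
      using AE_sum_le_of_AE_le_1[OF le, of n] by (simp add: M)
    then have "AE \<omega> in P. norm (g (M n \<omega>)) \<le> g (real n)"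
      by eventually_elim (use g smooth_payoff_mono[OF g] in \<open>auto simp: smooth_payoff_def\<close>)
    then have "integrable P (\<lambda>\<omega>. g (M n \<omega>))"
      by (rule integrable_const_bound) measurable
    then have "prob {\<omega> \<in> space P. M n \<omega> \<ge> x} \<le> expectation (\<lambda>\<omega>. g (M n \<omega>)) / g x"
      using \<open>g x > 0\<close> by (intro prob_ge_le_payoff[OF g]) auto
    also have "expectation (\<lambda>\<omega>. g (M n \<omega>)) \<le> fold bern xs g 0"
      unfolding xs_def
    proof (rule martingale_payoff_le[OF P M mart le _ v_pos g order_refl])
      show "AE \<omega> in P. cond_variance P (F (k - 1)) (X k) \<omega> \<le> ennreal (v (\<kappa>s k))" if "k \<in> {1..n}" for k
        using cond[OF that] by eventually_elim simp
    qed
    also have "fold bern xs g 0 \<le> fold bern (replicate n \<sigma>2) g 0"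
      using bern_fold_average[OF g xs_pos xs_sum] by (simp add: len)
    also have "\<dots> = (\<integral>\<omega>. g (\<Sum>k=1..n. Y k \<omega>) \<partial>N)"
      using Y indep_bernoulli_payoff[of N Y n \<sigma>2 g g' n] g \<sigma>2 by (simp add: indep_copies_def)
    finally show ?thesis
      using \<open>g x > 0\<close> by (simp add: divide_right_mono)
  qed
  have tail: "prob {\<omega> \<in> space P. M n \<omega> \<ge> x}
        \<le> (INF h\<in>{0<..}. exp (- h * x) * prob_space.expectation N (\<lambda>\<omega>. exp (h * (\<Sum>k=1..n. Y k \<omega>))))"
      "prob {\<omega> \<in> space P. M n \<omega> \<ge> x}
        \<le> (INF h\<in>{..<x}. (x - h) powi (- 2) * prob_space.expectation N (\<lambda>\<omega>. (max 0 ((\<Sum>k=1..n. Y k \<omega>) - h))\<^sup>2))"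
    if Y: "indep_copies N Y n (bernoulli_law \<sigma>2)" for N :: "'b measure" and Y x
  proof -
    show "prob {\<omega> \<in> space P. M n \<omega> \<ge> x}
        \<le> (INF h\<in>{0<..}. exp (- h * x) * prob_space.expectation N (\<lambda>\<omega>. exp (h * (\<Sum>k=1..n. Y k \<omega>))))"
    \<comment> \<open>For an infimum of reals a common lower bound is enough provided the index set
      is nonempty; each \<open>h\<close> is served by its own payoff in
      \<open>bound\<close>.\<close>
    proof (rule cINF_greatest)
      show "prob {\<omega> \<in> space P. M n \<omega> \<ge> x} \<le> exp (- h * x) * prob_space.expectation N (\<lambda>\<omega>. exp (h * (\<Sum>k=1..n. Y k \<omega>)))"
        if "h \<in> {0<..}" for h
        using bound[OF smooth_payoff_exp[of h] _ Y, of x] that by (simp add: exp_minus field_simps)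
    qed simp
    show "prob {\<omega> \<in> space P. M n \<omega> \<ge> x}
        \<le> (INF h\<in>{..<x}. (x - h) powi (- 2) * prob_space.expectation N (\<lambda>\<omega>. (max 0 ((\<Sum>k=1..n. Y k \<omega>) - h))\<^sup>2))"
    proof (rule cINF_greatest)
      show "prob {\<omega> \<in> space P. M n \<omega> \<ge> x}
          \<le> (x - h) powi (- 2) * prob_space.expectation N (\<lambda>\<omega>. (max 0 ((\<Sum>k=1..n. Y k \<omega>) - h))\<^sup>2)"
        if "h \<in> {..<x}" for h
        using bound[OF smooth_payoff_square_pos_part[of h] _ Y, of x] that
        by (simp add: power_int_minus divide_inverse mult.commute)
    qed auto
  qed
  have const: "\<kappa> = c \<and> \<sigma>2 = v c" if c: "\<forall>k\<in>{1..n}. \<kappa>s k = c" for c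
  proof -
    have "\<sigma>2 = v c"
      using c n by (simp add: assms(8))
    moreover have "c \<ge> 1"
      using \<kappa>s[of 1] c n by auto
    ultimately show ?thesis
      using v_root[of c] by (simp add: assms(9))
  qed
  show ?thesis
    using \<kappa>s \<sigma>2 mean var kurt tail const by auto
qed

end
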